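(* Let $R$ be a commutative Noetherian local ring of depth $t$. Let $M$ be a finitely generated $R$-module such that $\operatorname{depth}_R(M)\ge t-1$ and $\operatorname{Ext}_R^{i}(M,R)=0$ for all $1\le i\le t-1$. If $R$ is a direct summand of $M^*$, then $R$ is a direct summand of $M$.
   Context: $M^*:=\operatorname{Hom}_R(M,R)$. *)

theory Defs
  imports "HOL-Library.Extended_Nat" "HOL-Algebra.Module" "HOL-Algebra.Ring_Divisibility"
begin

section \<open>Local rings\<close>

definition local_ring :: "('a, 'r) ring_scheme \<Rightarrow> bool" where
  "local_ring R \<longleftrightarrow> cring R \<and> (\<exists>!I. maximalideal I R)"

definition max_ideal :: "('a, 'r) ring_scheme \<Rightarrow> 'a set" where
  "max_ideal R = (THE I. maximalideal I R)"

section \<open>Modules\<close>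

text \<open>
  The record type of modules extends the one of rings; the fields \<open>mult\<close> and \<open>one\<close>
  play no role for a module and are left undefined below.
\<close>

definition regular_module :: "('a, 'r) ring_scheme \<Rightarrow> ('a, 'a) module" where
  "regular_module R =
     \<lparr>carrier = carrier R, mult = undefined, one = undefined,
      zero = zero R, add = add R, smult = mult R\<rparr>"

definition zero_module :: "('a, 'm, 's) module_scheme \<Rightarrow> bool" where
  "zero_module M \<longleftrightarrow> carrier M = {\<zero>\<^bsub>M\<^esub>}"

definition module_span ::
  "('a, 'r) ring_scheme \<Rightarrow> ('a, 'm, 's) module_scheme \<Rightarrow> 'm set \<Rightarrow> 'm set" where
  "module_span R M A = \<Inter>{H. submodule H R M \<and> A \<subseteq> H}"

definition finitely_generated ::
  "('a, 'r) ring_scheme \<Rightarrow> ('a, 'm, 's) module_scheme \<Rightarrow> bool" where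
  "finitely_generated R M \<longleftrightarrow>
     (\<exists>A. finite A \<and> A \<subseteq> carrier M \<and> module_span R M A = carrier M)"

definition quot_module ::
  "('a, 'm, 's) module_scheme \<Rightarrow> 'm set \<Rightarrow> ('a, 'm set) module" where
  "quot_module M H =
     \<lparr>carrier = a_rcosets\<^bsub>M\<^esub> H, mult = undefined, one = undefined,
      zero = H, add = set_add M, smult = (\<lambda>a C. \<Union>x\<in>C. H +>\<^bsub>M\<^esub> (a \<odot>\<^bsub>M\<^esub> x))\<rparr>"

text \<open>Homomorphisms are extensional, so that two of them are equal iff they agree on the domain.\<close>

definition mod_hom ::
  "('a, 'r) ring_scheme \<Rightarrow> ('a, 'm, 's) module_scheme \<Rightarrow> ('a, 'n, 'q) module_scheme \<Rightarrow> ('m \<Rightarrow> 'n) set"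
  where
  "mod_hom R M N =
     {f \<in> carrier M \<rightarrow>\<^sub>E carrier N.
        (\<forall>x\<in>carrier M. \<forall>y\<in>carrier M. f (x \<oplus>\<^bsub>M\<^esub> y) = f x \<oplus>\<^bsub>N\<^esub> f y) \<and>
        (\<forall>a\<in>carrier R. \<forall>x\<in>carrier M. f (a \<odot>\<^bsub>M\<^esub> x) = a \<odot>\<^bsub>N\<^esub> f x)}"

definition Hom_module ::
  "('a, 'r) ring_scheme \<Rightarrow> ('a, 'm, 's) module_scheme \<Rightarrow> ('a, 'n, 'q) module_scheme
    \<Rightarrow> ('a, 'm \<Rightarrow> 'n) module" where
  "Hom_module R M N =
     \<lparr>carrier = mod_hom R M N, mult = undefined, one = undefined,
      zero = (\<lambda>x\<in>carrier M. \<zero>\<^bsub>N\<^esub>),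
      add = (\<lambda>f g. \<lambda>x\<in>carrier M. f x \<oplus>\<^bsub>N\<^esub> g x),
      smult = (\<lambda>a f. \<lambda>x\<in>carrier M. a \<odot>\<^bsub>N\<^esub> f x)\<rparr>"

definition dual_module ::
  "('a, 'r) ring_scheme \<Rightarrow> ('a, 'm, 's) module_scheme \<Rightarrow> ('a, 'm \<Rightarrow> 'a) module" where
  "dual_module R M = Hom_module R M (regular_module R)"

definition module_isomorphic ::
  "('a, 'r) ring_scheme \<Rightarrow> ('a, 'm, 's) module_scheme \<Rightarrow> ('a, 'n, 'q) module_scheme \<Rightarrow> bool" where
  "module_isomorphic R M N \<longleftrightarrow>
     (\<exists>f\<in>mod_hom R M N. bij_betw f (carrier M) (carrier N))"

text \<open>\<open>N\<close> is a direct summand of \<open>M\<close>: \<open>M\<close> is the internal direct sum of submodules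
  \<open>A\<close> and \<open>B\<close> with \<open>A\<close> isomorphic to \<open>N\<close>.\<close>

definition direct_summand ::
  "('a, 'r) ring_scheme \<Rightarrow> ('a, 'n, 'q) module_scheme \<Rightarrow> ('a, 'm, 's) module_scheme \<Rightarrow> bool" where
  "direct_summand R N M \<longleftrightarrow>
     (\<exists>A B. submodule A R M \<and> submodule B R M \<and>
        A <+>\<^bsub>M\<^esub> B = carrier M \<and> A \<inter> B = {\<zero>\<^bsub>M\<^esub>} \<and>
        module_isomorphic R N (M\<lparr>carrier := A\<rparr>))"

section \<open>Depth\<close>

definition ideal_smult ::
  "('a, 'r) ring_scheme \<Rightarrow> 'a set \<Rightarrow> ('a, 'm, 's) module_scheme \<Rightarrow> 'm set" where
  "ideal_smult R I M = module_span R M {a \<odot>\<^bsub>M\<^esub> x | a x. a \<in> I \<and> x \<in> carrier M}"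

definition regular_element :: "('a, 'm, 's) module_scheme \<Rightarrow> 'a \<Rightarrow> bool" where
  "regular_element M a \<longleftrightarrow> (\<forall>x\<in>carrier M. a \<odot>\<^bsub>M\<^esub> x = \<zero>\<^bsub>M\<^esub> \<longrightarrow> x = \<zero>\<^bsub>M\<^esub>)"

definition regular_sequence ::
  "('a, 'r) ring_scheme \<Rightarrow> ('a, 'm, 's) module_scheme \<Rightarrow> 'a list \<Rightarrow> bool" where
  "regular_sequence R M xs \<longleftrightarrow> set xs \<subseteq> carrier R \<and>
     (\<forall>i<length xs. regular_element
        (quot_module M (ideal_smult R (genideal R (set (take i xs))) M)) (xs ! i)) \<and>
     \<not> zero_module (quot_module M (ideal_smult R (genideal R (set xs)) M))"

text \<open>Depth over a local ring, with the usual convention that the zero module has depth \<open>\<infinity>\<close>.\<close>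

definition depth :: "('a, 'r) ring_scheme \<Rightarrow> ('a, 'm, 's) module_scheme \<Rightarrow> enat" where
  "depth R M = (if zero_module M then \<infinity>
     else Sup {enat (length xs) | xs. set xs \<subseteq> max_ideal R \<and> regular_sequence R M xs})"

section \<open>The standard free resolution\<close>

text \<open>The free module on the set \<open>B\<close>: finitely supported functions from \<open>B\<close> to \<open>R\<close>,
  extended by zero outside of \<open>B\<close>.\<close>

definition free_module :: "('a, 'r) ring_scheme \<Rightarrow> 'b set \<Rightarrow> ('a, 'b \<Rightarrow> 'a) module" where
  "free_module R B =
     \<lparr>carrier = {f. range f \<subseteq> carrier R \<and> finite {b. f b \<noteq> \<zero>\<^bsub>R\<^esub>} \<and> {b. f b \<noteq> \<zero>\<^bsub>R\<^esub>} \<subseteq> B},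
      mult = undefined, one = undefined,
      zero = (\<lambda>b. \<zero>\<^bsub>R\<^esub>),
      add = (\<lambda>f g b. f b \<oplus>\<^bsub>R\<^esub> g b),
      smult = (\<lambda>a f b. a \<otimes>\<^bsub>R\<^esub> f b)\<rparr>"

definition linear_extension ::
  "('a, 'r) ring_scheme \<Rightarrow> 'b set \<Rightarrow> ('a, 'm, 's) module_scheme \<Rightarrow> ('b \<Rightarrow> 'm) \<Rightarrow> ('b \<Rightarrow> 'a) \<Rightarrow> 'm" where
  "linear_extension R B M g =
     (\<lambda>f\<in>carrier (free_module R B). \<Oplus>\<^bsub>M\<^esub>b\<in>{b. f b \<noteq> \<zero>\<^bsub>R\<^esub>}. f b \<odot>\<^bsub>M\<^esub> g b)"

text \<open>
  A free resolution of an arbitrary module \<open>M\<close> all of whose terms live in one HOL type.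
  The basis in degree \<open>0\<close> is \<open>M\<close> itself (via \<open>Gen\<close>). A basis element in degree \<open>n + 1\<close> is
  \<open>Rel l\<close>, where the association list \<open>l\<close> represents a finitely supported function, namely
  an element of the kernel of the map out of degree \<open>n\<close>; that element is the image of
  \<open>Rel l\<close> under the differential.
\<close>

datatype ('a, 'm) cell = Gen (gen_of: 'm) | Rel (rel_of: "(('a, 'm) cell \<times> 'a) list")

definition coeffs_of :: "('a, 'r) ring_scheme \<Rightarrow> ('b \<times> 'a) list \<Rightarrow> 'b \<Rightarrow> 'a" where
  "coeffs_of R l b = (case map_of l b of None \<Rightarrow> \<zero>\<^bsub>R\<^esub> | Some a \<Rightarrow> a)"

fun cells :: "('a, 'r) ring_scheme \<Rightarrow> ('a, 'm, 's) module_scheme \<Rightarrow> nat \<Rightarrow> ('a, 'm) cell set" where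
  "cells R M 0 = Gen ` carrier M"
| "cells R M (Suc 0) =
     {Rel l | l. coeffs_of R l \<in>
        a_kernel (free_module R (cells R M 0)) M (linear_extension R (cells R M 0) M gen_of)}"
| "cells R M (Suc (Suc n)) =
     {Rel l | l. coeffs_of R l \<in>
        a_kernel (free_module R (cells R M (Suc n))) (free_module R (cells R M n))
          (linear_extension R (cells R M (Suc n)) (free_module R (cells R M n))
            (\<lambda>c. coeffs_of R (rel_of c)))}"

definition res_term ::
  "('a, 'r) ring_scheme \<Rightarrow> ('a, 'm, 's) module_scheme \<Rightarrow> nat \<Rightarrow> ('a, ('a, 'm) cell \<Rightarrow> 'a) module" where
  "res_term R M n = free_module R (cells R M n)"

definition res_diff ::
  "('a, 'r) ring_scheme \<Rightarrow> ('a, 'm, 's) module_scheme \<Rightarrow> nat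
    \<Rightarrow> (('a, 'm) cell \<Rightarrow> 'a) \<Rightarrow> (('a, 'm) cell \<Rightarrow> 'a)" where
  "res_diff R M n =
     linear_extension R (cells R M (Suc n)) (res_term R M n) (\<lambda>c. coeffs_of R (rel_of c))"

definition res_aug ::
  "('a, 'r) ring_scheme \<Rightarrow> ('a, 'm, 's) module_scheme \<Rightarrow> (('a, 'm) cell \<Rightarrow> 'a) \<Rightarrow> 'm" where
  "res_aug R M = linear_extension R (cells R M 0) M gen_of"

lemma free_module_simps:
  "f \<in> carrier (free_module R B) \<longleftrightarrow>
     (\<forall>b. f b \<in> carrier R) \<and> finite {b. f b \<noteq> \<zero>\<^bsub>R\<^esub>} \<and> {b. f b \<noteq> \<zero>\<^bsub>R\<^esub>} \<subseteq> B"
  "\<zero>\<^bsub>free_module R B\<^esub> = (\<lambda>b. \<zero>\<^bsub>R\<^esub>)"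
  "f \<oplus>\<^bsub>free_module R B\<^esub> g = (\<lambda>b. f b \<oplus>\<^bsub>R\<^esub> g b)"
  "a \<odot>\<^bsub>free_module R B\<^esub> f = (\<lambda>b. a \<otimes>\<^bsub>R\<^esub> f b)"
  by (auto simp: free_module_def)

lemma module_free_module:
  assumes "cring R"
  shows "module R (free_module R B)"
proof -
  interpret cring R by fact
  have add: "(\<lambda>b. f b \<oplus>\<^bsub>R\<^esub> g b) \<in> carrier (free_module R B)"
    if "f \<in> carrier (free_module R B)" "g \<in> carrier (free_module R B)" for f g
  proof -
    have sub: "{b. f b \<oplus>\<^bsub>R\<^esub> g b \<noteq> \<zero>\<^bsub>R\<^esub>} \<subseteq> {b. f b \<noteq> \<zero>\<^bsub>R\<^esub>} \<union> {b. g b \<noteq> \<zero>\<^bsub>R\<^esub>}" by auto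
    show ?thesis using that finite_subset[OF sub] sub by (auto simp: free_module_simps)
  qed
  have smult: "(\<lambda>b. a \<otimes>\<^bsub>R\<^esub> f b) \<in> carrier (free_module R B)"
    if "f \<in> carrier (free_module R B)" "a \<in> carrier R" for f a
  proof -
    have sub: "{b. a \<otimes>\<^bsub>R\<^esub> f b \<noteq> \<zero>\<^bsub>R\<^esub>} \<subseteq> {b. f b \<noteq> \<zero>\<^bsub>R\<^esub>}" using that by auto
    show ?thesis using that finite_subset[OF sub] sub by (auto simp: free_module_simps)
  qed
  have inv: "\<exists>g\<in>carrier (free_module R B). (\<lambda>b. g b \<oplus>\<^bsub>R\<^esub> f b) = (\<lambda>b. \<zero>\<^bsub>R\<^esub>)"
    if "f \<in> carrier (free_module R B)" for f
    using that
    by (intro bexI[OF _ smult[OF that, of "\<ominus>\<^bsub>R\<^esub> \<one>\<^bsub>R\<^esub>"]])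
       (auto simp: free_module_simps l_minus l_neg)
  show ?thesis
  proof (rule moduleI)
    show "abelian_group (free_module R B)"
    proof (rule abelian_groupI)
      show "\<zero>\<^bsub>free_module R B\<^esub> \<in> carrier (free_module R B)" by (auto simp: free_module_simps)
    qed (use add inv in \<open>auto simp: free_module_simps(2,3)\<close>, 
         auto simp: free_module_simps a_ac)
  qed (use smult in \<open>auto simp: free_module_simps(4) assms\<close>,
       auto simp: free_module_simps l_distr r_distr m_assoc)
qed

lemma linear_extension_hom:
  assumes "module R M" "g \<in> B \<rightarrow> carrier M"
  shows "linear_extension R B M g \<in> mod_hom R (free_module R B) M"
proof -
  interpret module R M by fact
  interpret F: module R "free_module R B" by (rule module_free_module) (rule R.is_cring)
  define L where "L = linear_extension R B M g"
  have term_closed: "f b \<odot>\<^bsub>M\<^esub> g b \<in> carrier M"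
    if "f \<in> carrier (free_module R B)" "b \<in> B" for f b
    using that assms(2) by (auto simp: free_module_simps)
  have L_eq: "L f = (\<Oplus>\<^bsub>M\<^esub>b\<in>S. f b \<odot>\<^bsub>M\<^esub> g b)"
    if "f \<in> carrier (free_module R B)" "finite S" "{b. f b \<noteq> \<zero>\<^bsub>R\<^esub>} \<subseteq> S" "S \<subseteq> B" for f S
    unfolding L_def linear_extension_def restrict_apply'[OF that(1)]
    using that term_closed[OF that(1)] assms(2)
    by (intro M.add.finprod_mono_neutral_cong_left) (auto simp: subset_eq Pi_def)
  have supp: "finite {b. f b \<noteq> \<zero>\<^bsub>R\<^esub>}" "{b. f b \<noteq> \<zero>\<^bsub>R\<^esub>} \<subseteq> B"
    if "f \<in> carrier (free_module R B)" for f
    using that by (auto simp: free_module_simps)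
  have "L f \<in> carrier M" if "f \<in> carrier (free_module R B)" for f
    unfolding L_eq[OF that supp(1)[OF that] order_refl supp(2)[OF that]]
    using term_closed[OF that] supp(2)[OF that] by (intro M.finsum_closed) auto
  moreover have "L (f \<oplus>\<^bsub>free_module R B\<^esub> h) = L f \<oplus>\<^bsub>M\<^esub> L h"
    if f: "f \<in> carrier (free_module R B)" and h: "h \<in> carrier (free_module R B)" for f h
  proof -
    define S where "S = {b. f b \<noteq> \<zero>\<^bsub>R\<^esub>} \<union> {b. h b \<noteq> \<zero>\<^bsub>R\<^esub>}"
    have S: "finite S" "S \<subseteq> B" using supp[OF f] supp[OF h] by (auto simp: S_def)
    have "L (f \<oplus>\<^bsub>free_module R B\<^esub> h) = (\<Oplus>\<^bsub>M\<^esub>b\<in>S. (f \<oplus>\<^bsub>free_module R B\<^esub> h) b \<odot>\<^bsub>M\<^esub> g b)"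
      using S f h F.M.a_closed[OF f h] by (intro L_eq) (auto simp: S_def free_module_simps(3))
    also have "\<dots> = (\<Oplus>\<^bsub>M\<^esub>b\<in>S. f b \<odot>\<^bsub>M\<^esub> g b \<oplus>\<^bsub>M\<^esub> h b \<odot>\<^bsub>M\<^esub> g b)"
      using S f h assms(2) term_closed
      by (intro M.finsum_cong') (auto simp: free_module_simps smult_l_distr subset_eq Pi_def)
    also have "\<dots> = (\<Oplus>\<^bsub>M\<^esub>b\<in>S. f b \<odot>\<^bsub>M\<^esub> g b) \<oplus>\<^bsub>M\<^esub> (\<Oplus>\<^bsub>M\<^esub>b\<in>S. h b \<odot>\<^bsub>M\<^esub> g b)"
      using S f h term_closed by (intro M.finsum_addf) auto
    also have "\<dots> = L f \<oplus>\<^bsub>M\<^esub> L h"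
      using S f h by (subst (1 2) L_eq[of _ S]) (auto simp: S_def)
    finally show ?thesis .
  qed
  moreover have "L (a \<odot>\<^bsub>free_module R B\<^esub> f) = a \<odot>\<^bsub>M\<^esub> L f"
    if a: "a \<in> carrier R" and f: "f \<in> carrier (free_module R B)" for a f
  proof -
    define S where "S = {b. f b \<noteq> \<zero>\<^bsub>R\<^esub>}"
    have S: "finite S" "S \<subseteq> B" using supp[OF f] by (auto simp: S_def)
    have "L (a \<odot>\<^bsub>free_module R B\<^esub> f) = (\<Oplus>\<^bsub>M\<^esub>b\<in>S. (a \<odot>\<^bsub>free_module R B\<^esub> f) b \<odot>\<^bsub>M\<^esub> g b)"
      using S a f F.smult_closed[OF a f] by (intro L_eq) (auto simp: S_def free_module_simps(4))
    also have "\<dots> = (\<Oplus>\<^bsub>M\<^esub>b\<in>S. a \<odot>\<^bsub>M\<^esub> (f b \<odot>\<^bsub>M\<^esub> g b))"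
      using S a f assms(2) term_closed
      by (intro M.finsum_cong') (auto simp: free_module_simps smult_assoc1 subset_eq Pi_def)
    also have "\<dots> = a \<odot>\<^bsub>M\<^esub> (\<Oplus>\<^bsub>M\<^esub>b\<in>S. f b \<odot>\<^bsub>M\<^esub> g b)"
      using S a f term_closed by (intro finsum_smult_ldistr[symmetric]) auto
    also have "\<dots> = a \<odot>\<^bsub>M\<^esub> L f"
      using S f by (subst L_eq[of _ S]) (auto simp: S_def)
    finally show ?thesis .
  qed
  moreover have "L \<in> extensional (carrier (free_module R B))"
    by (auto simp: L_def linear_extension_def)
  ultimately show ?thesis unfolding L_def[symmetric] mod_hom_def
    by (simp add: PiE_iff)
qed

lemma linear_extension_surj:
  assumes "module R M" "g \<in> B \<rightarrow> carrier M" "b \<in> B"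
  shows "g b \<in> linear_extension R B M g ` carrier (free_module R B)"
proof -
  interpret module R M by fact
  define e where "e = (\<lambda>c. if c = b then \<one>\<^bsub>R\<^esub> else \<zero>\<^bsub>R\<^esub>)"
  have sub: "{c. e c \<noteq> \<zero>\<^bsub>R\<^esub>} \<subseteq> {b}" by (auto simp: e_def)
  have e: "e \<in> carrier (free_module R B)"
    using assms(3) finite_subset[OF sub] by (auto simp: free_module_simps e_def)
  have gb: "g b \<in> carrier M" using assms by auto
  have "linear_extension R B M g e = g b"
  proof (cases "\<one>\<^bsub>R\<^esub> = \<zero>\<^bsub>R\<^esub>")
    case True
    then have "g b = \<zero>\<^bsub>M\<^esub>" using gb smult_one[OF gb] by simp
    moreover have "{c. e c \<noteq> \<zero>\<^bsub>R\<^esub>} = {}" using True by (auto simp: e_def)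
    ultimately show ?thesis using e by (simp add: linear_extension_def)
  next
    case False
    then have "{c. e c \<noteq> \<zero>\<^bsub>R\<^esub>} = {b}" by (auto simp: e_def)
    then show ?thesis using e gb by (simp add: linear_extension_def e_def)
  qed
  then show ?thesis using e by (metis imageI)
qed

lemma coeffs_of_surj:
  assumes "f \<in> carrier (free_module R B)"
  shows "\<exists>l. coeffs_of R l = f"
proof -
  obtain bs where bs: "set bs = {b. f b \<noteq> \<zero>\<^bsub>R\<^esub>}"
    using assms finite_list[of "{b. f b \<noteq> \<zero>\<^bsub>R\<^esub>}"] unfolding free_module_simps(1) by blast
  have "coeffs_of R (map (\<lambda>b. (b, f b)) bs) = f"
    by (auto simp: coeffs_of_def map_of_map_restrict restrict_map_def bs fun_eq_iff)
  then show ?thesis by blast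
qed

lemma a_kernel_eq: "a_kernel M N h = {x \<in> carrier M. h x = \<zero>\<^bsub>N\<^esub>}"
  by (simp add: a_kernel_def kernel_def)

lemma image_span_kernel:
  assumes M: "module R M" and N: "module R N" and g: "g \<in> B \<rightarrow> carrier M"
    and h: "h \<in> mod_hom R M N" and img: "g ` B = a_kernel M N h"
  shows "linear_extension R B M g ` carrier (free_module R B) = a_kernel M N h"
proof
  interpret M: module R M by fact
  interpret N: module R N by fact
  show "a_kernel M N h \<subseteq> linear_extension R B M g ` carrier (free_module R B)"
    using linear_extension_surj[OF M g] by (auto simp flip: img)
  have h_add: "h (x \<oplus>\<^bsub>M\<^esub> y) = h x \<oplus>\<^bsub>N\<^esub> h y" if "x \<in> carrier M" "y \<in> carrier M" for x y
    using h that by (auto simp: mod_hom_def)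
  have h_sm: "h (a \<odot>\<^bsub>M\<^esub> x) = a \<odot>\<^bsub>N\<^esub> h x" if "a \<in> carrier R" "x \<in> carrier M" for a x
    using h that by (auto simp: mod_hom_def)
  have h0: "h \<zero>\<^bsub>M\<^esub> = \<zero>\<^bsub>N\<^esub>"
    using h_sm[OF M.R.zero_closed M.M.zero_closed] h
    by (auto simp: mod_hom_def PiE_mem[of h "carrier M" "\<lambda>_. carrier N"])
  have "(\<Oplus>\<^bsub>M\<^esub>b\<in>S. f b \<odot>\<^bsub>M\<^esub> g b) \<in> a_kernel M N h"
    if "finite S" "S \<subseteq> B" "\<forall>b. f b \<in> carrier R" for S f
    using that
  proof (induction S rule: finite_induct)
    case empty
    then show ?case by (simp add: a_kernel_eq h0)
  next
    case (insert b S)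
    have gb: "g b \<in> carrier M" "h (g b) = \<zero>\<^bsub>N\<^esub>"
      using insert.prems img by (auto simp: a_kernel_eq)
    have cl: "(\<lambda>b. f b \<odot>\<^bsub>M\<^esub> g b) \<in> S \<rightarrow> carrier M"
      using insert.prems g by auto
    show ?case
      using insert gb cl by (simp add: a_kernel_eq h_add h_sm)
  qed
  then show "linear_extension R B M g ` carrier (free_module R B) \<subseteq> a_kernel M N h"
    by (auto simp: linear_extension_def free_module_simps)
qed

lemma coeffs_of_image:
  assumes "K \<subseteq> carrier (free_module R B)"
  shows "(\<lambda>c. coeffs_of R (rel_of c)) ` {Rel l | l. coeffs_of R l \<in> K} = K"
proof (intro equalityI subsetI)
  fix f assume "f \<in> K"
  moreover from this obtain l where "coeffs_of R l = f" using assms coeffs_of_surj by blast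
  ultimately show "f \<in> (\<lambda>c. coeffs_of R (rel_of c)) ` {Rel l | l. coeffs_of R l \<in> K}"
    by (intro image_eqI[of _ _ "Rel l"]) auto
qed auto

text \<open>\<open>\<cdots> \<rightarrow> res_term R M 1 \<rightarrow> res_term R M 0 \<rightarrow> M \<rightarrow> 0\<close> is exact.\<close>

theorem free_resolution:
  assumes M: "module R M"
  shows "res_aug R M \<in> mod_hom R (res_term R M 0) M"
    and "res_aug R M ` carrier (res_term R M 0) = carrier M"
    and "res_diff R M n \<in> mod_hom R (res_term R M (Suc n)) (res_term R M n)"
    and "res_diff R M 0 ` carrier (res_term R M 1) = a_kernel (res_term R M 0) M (res_aug R M)"
    and "res_diff R M (Suc n) ` carrier (res_term R M (Suc (Suc n))) =
           a_kernel (res_term R M (Suc n)) (res_term R M n) (res_diff R M n)"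
proof -
  interpret module R M by fact
  note free = module_free_module[OF R.is_cring]
  let ?g = "\<lambda>c. coeffs_of R (rel_of c)"
  have gen: "gen_of \<in> cells R M 0 \<rightarrow> carrier M" by auto
  show aug: "res_aug R M \<in> mod_hom R (res_term R M 0) M"
    unfolding res_aug_def res_term_def by (rule linear_extension_hom[OF M gen])
  show "res_aug R M ` carrier (res_term R M 0) = carrier M"
  proof
    show "res_aug R M ` carrier (res_term R M 0) \<subseteq> carrier M"
      using aug by (auto simp: mod_hom_def)
    show "carrier M \<subseteq> res_aug R M ` carrier (res_term R M 0)"
    proof
      fix x assume "x \<in> carrier M"
      then have "Gen x \<in> cells R M 0" by simp
      from linear_extension_surj[OF M gen this] show "x \<in> res_aug R M ` carrier (res_term R M 0)"
        unfolding res_aug_def res_term_def cell.sel .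
    qed
  qed
  have img0: "?g ` cells R M (Suc 0) = a_kernel (res_term R M 0) M (res_aug R M)"
    unfolding cells.simps(2) res_term_def res_aug_def
    by (rule coeffs_of_image[where B = "cells R M 0"]) (auto simp: a_kernel_eq)
  have imgS: "?g ` cells R M (Suc (Suc n)) =
      a_kernel (res_term R M (Suc n)) (res_term R M n) (res_diff R M n)" for n
    unfolding cells.simps(3) res_term_def res_diff_def
    by (rule coeffs_of_image[where B = "cells R M (Suc n)"]) (auto simp: a_kernel_eq)
  have g: "?g \<in> cells R M (Suc n) \<rightarrow> carrier (res_term R M n)" for n
  proof -
    have "?g ` cells R M (Suc n) \<subseteq> carrier (res_term R M n)"
    proof (cases n)
      case 0
      show ?thesis unfolding 0 img0 a_kernel_eq by (rule Collect_restrict)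
    next
      case (Suc k)
      show ?thesis unfolding Suc imgS a_kernel_eq by (rule Collect_restrict)
    qed
    then show ?thesis by (simp only: image_subset_iff_funcset)
  qed
  show diff: "res_diff R M n \<in> mod_hom R (res_term R M (Suc n)) (res_term R M n)" for n
    unfolding res_diff_def res_term_def
    by (rule linear_extension_hom[OF free]) (use g in \<open>simp add: res_term_def\<close>)
  show "res_diff R M 0 ` carrier (res_term R M 1) = a_kernel (res_term R M 0) M (res_aug R M)"
    using image_span_kernel[OF free[of "cells R M 0"] M g[of 0, unfolded res_term_def]
        aug[unfolded res_term_def] img0[unfolded res_term_def]]
    by (simp add: res_diff_def res_term_def)
  show "res_diff R M (Suc n) ` carrier (res_term R M (Suc (Suc n))) =
           a_kernel (res_term R M (Suc n)) (res_term R M n) (res_diff R M n)"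
    using image_span_kernel[OF free[of "cells R M (Suc n)"] free[of "cells R M n"]
        g[of "Suc n", unfolded res_term_def] diff[of n, unfolded res_term_def]
        imgS[of n, unfolded res_term_def]]
    by (simp add: res_diff_def res_term_def)
qed

section \<open>Ext\<close>

definition Hom_diff ::
  "('a, 'r) ring_scheme \<Rightarrow> (nat \<Rightarrow> ('a, 'p, 't) module_scheme) \<Rightarrow> (nat \<Rightarrow> 'p \<Rightarrow> 'p)
    \<Rightarrow> ('a, 'n, 'q) module_scheme \<Rightarrow> nat \<Rightarrow> ('p \<Rightarrow> 'n) \<Rightarrow> ('p \<Rightarrow> 'n)" where
  "Hom_diff R F d N n f = (\<lambda>x\<in>carrier (F (Suc n)). f (d n x))"

definition cocycles ::
  "('a, 'r) ring_scheme \<Rightarrow> (nat \<Rightarrow> ('a, 'p, 't) module_scheme) \<Rightarrow> (nat \<Rightarrow> 'p \<Rightarrow> 'p)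
    \<Rightarrow> ('a, 'n, 'q) module_scheme \<Rightarrow> nat \<Rightarrow> ('p \<Rightarrow> 'n) set" where
  "cocycles R F d N n =
     a_kernel (Hom_module R (F n) N) (Hom_module R (F (Suc n)) N) (Hom_diff R F d N n)"

fun coboundaries ::
  "('a, 'r) ring_scheme \<Rightarrow> (nat \<Rightarrow> ('a, 'p, 't) module_scheme) \<Rightarrow> (nat \<Rightarrow> 'p \<Rightarrow> 'p)
    \<Rightarrow> ('a, 'n, 'q) module_scheme \<Rightarrow> nat \<Rightarrow> ('p \<Rightarrow> 'n) set" where
  "coboundaries R F d N 0 = {\<zero>\<^bsub>Hom_module R (F 0) N\<^esub>}"
| "coboundaries R F d N (Suc n) = Hom_diff R F d N n ` carrier (Hom_module R (F n) N)"

definition Hom_cohomology ::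
  "('a, 'r) ring_scheme \<Rightarrow> (nat \<Rightarrow> ('a, 'p, 't) module_scheme) \<Rightarrow> (nat \<Rightarrow> 'p \<Rightarrow> 'p)
    \<Rightarrow> ('a, 'n, 'q) module_scheme \<Rightarrow> nat \<Rightarrow> ('a, ('p \<Rightarrow> 'n) set) module" where
  "Hom_cohomology R F d N n =
     quot_module ((Hom_module R (F n) N)\<lparr>carrier := cocycles R F d N n\<rparr>) (coboundaries R F d N n)"

definition Ext ::
  "('a, 'r) ring_scheme \<Rightarrow> nat \<Rightarrow> ('a, 'm, 's) module_scheme \<Rightarrow> ('a, 'n, 'q) module_scheme
    \<Rightarrow> ('a, ((('a, 'm) cell \<Rightarrow> 'a) \<Rightarrow> 'n) set) module" where
  "Ext R i M N = Hom_cohomology R (res_term R M) (res_diff R M) N i"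

end

theory Submission
  imports Defs
begin

text \<open>
  Let \<open>x\<^sub>1, \<dots>, x\<^sub>t\<close> be a maximal regular sequence on \<open>R\<close>, \<open>I j = (x\<^sub>1, \<dots>, x\<^sub>j)\<close>, and \<open>y\<close> an element
  outside \<open>I t\<close> with \<open>\<mm> y \<subseteq> I t\<close>. The vanishing of \<open>Ext\<close> makes \<open>M\<^sup>* \<rightarrow> Hom(M, R/I j)\<close> surjective
  for \<open>j < t\<close>, whence every \<open>f \<in> M\<^sup>*\<close> with values in \<open>I t\<close> lies in \<open>I t M\<^sup>*\<close>, and every
  \<open>\<phi> : M\<^sup>* \<rightarrow> R\<close> maps it into \<open>I t\<close>. If \<open>R\<close> is a summand of \<open>M\<^sup>*\<close>, choose \<open>\<phi>\<close> and \<open>f\<close> with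
  \<open>\<phi> f = 1\<close>. Were \<open>f(M) \<subseteq> \<mm>\<close>, then \<open>y f\<close> would have values in \<open>I t\<close>, so \<open>y = \<phi> (y f) \<in> I t\<close>,
  a contradiction. Hence \<open>f\<close> is onto and splits.
\<close>

section \<open>Ideals of zero divisors in Noetherian rings\<close>

text \<open>Zorn's lemma applies without any closure of \<open>S\<close> under unions: by the
  ascending chain condition a nonempty chain of ideals contains its own union.\<close>

lemma (in noetherian_ring) exists_maximal_above:
  assumes S: "\<And>I. I \<in> S \<Longrightarrow> ideal I R" and J: "J \<in> S"
  shows "\<exists>I\<in>S. J \<subseteq> I \<and> (\<forall>K\<in>S. I \<subseteq> K \<longrightarrow> K = I)"
proof -
  let ?T = "{I \<in> S. J \<subseteq> I}"
  have "\<exists>I\<in>?T. \<forall>K\<in>?T. I \<subseteq> K \<longrightarrow> K = I"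
  proof (rule subset_Zorn_nonempty)
    show "?T \<noteq> {}" using J by blast
    fix C assume "C \<noteq> {}" "subset.chain ?T C"
    moreover from this have "subset.chain {I. ideal I R} C"
      using S by (auto simp: pred_on.chain_def)
    ultimately have "\<Union>C \<in> C" "C \<subseteq> ?T"
      using ideal_chain_is_trivial by (auto simp: pred_on.chain_def)
    then show "\<Union>C \<in> ?T" by blast
  qed
  then obtain I where I: "I \<in> S" "J \<subseteq> I" "\<And>K. K \<in> S \<Longrightarrow> J \<subseteq> K \<Longrightarrow> I \<subseteq> K \<Longrightarrow> K = I" by auto
  then have "\<forall>K\<in>S. I \<subseteq> K \<longrightarrow> K = I" by (meson subset_trans)
  then show ?thesis using I(1,2) by auto
qed

section \<open>Prime ideals, finite intersections and prime avoidance\<close>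

lemma (in cring) idealI':
  assumes "I \<subseteq> carrier R" "\<zero> \<in> I" "\<And>a b. a \<in> I \<Longrightarrow> b \<in> I \<Longrightarrow> a \<oplus> b \<in> I"
    and m: "\<And>a x. a \<in> I \<Longrightarrow> x \<in> carrier R \<Longrightarrow> x \<otimes> a \<in> I"
  shows "ideal I R"
proof (rule idealI[OF ring_axioms])
  show "subgroup I (add_monoid R)"
  proof (rule add.subgroupI)
    fix a assume a: "a \<in> I"
    then have "\<ominus> a = (\<ominus> \<one>) \<otimes> a" using assms(1) by (auto simp: l_minus)
    then show "\<ominus> a \<in> I" using m[OF a, of "\<ominus> \<one>"] by simp
  qed (use assms in auto)
  show "a \<otimes> x \<in> I" if "a \<in> I" "x \<in> carrier R" for a x
    using m[OF that] that assms(1) m_comm[of a x] by auto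
qed (use m in auto)

lemma (in ring) mem_ideal_addD:
  assumes "ideal I R" "a \<oplus> b \<in> I" "b \<in> I" "a \<in> carrier R"
  shows "a \<in> I"
proof -
  interpret ideal I R by fact
  have b: "b \<in> carrier R" using assms by simp
  have "(a \<oplus> b) \<oplus> \<ominus> b \<in> I" using assms by auto
  then show ?thesis using b assms(4) by (simp add: a_assoc r_neg)
qed

text \<open>If each \<open>I\<close> had an element outside \<open>P\<close>, the product of these
  elements would lie in every \<open>I\<close> but, by primality, not in \<open>P\<close>. The
  factor \<open>carrier R\<close> matters for empty \<open>F\<close>, where \<open>\<Inter>F\<close>
  is the whole type.\<close>

lemma (in cring) prime_contains_Inter:
  assumes "finite F" "primeideal P R" "\<And>I. I \<in> F \<Longrightarrow> ideal I R" "carrier R \<inter> \<Inter>F \<subseteq> P"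
  shows "\<exists>I\<in>F. I \<subseteq> P"
proof (rule ccontr)
  interpret P: primeideal P R by fact
  assume n: "\<not> (\<exists>I\<in>F. I \<subseteq> P)"
  have "\<exists>y. y \<in> carrier R \<inter> \<Inter>F \<and> y \<notin> P"
    using assms(1,3) n
  proof (induction F rule: finite_induct)
    case empty
    then show ?case using P.I_notcarr P.a_subset by blast
  next
    case (insert I F)
    interpret I: ideal I R using insert.prems by simp
    obtain y where y: "y \<in> carrier R" "y \<in> \<Inter>F" "y \<notin> P" using insert by blast
    obtain z where z: "z \<in> I" "z \<notin> P" using insert.prems by blast
    have zc: "z \<in> carrier R" using z by simp
    have "y \<otimes> z \<in> K" if "K \<in> F" for K
      using that y zc insert.prems ideal.I_r_closed[of K R] by auto
    moreover have "y \<otimes> z \<in> I" using y z I.I_l_closed by blast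
    moreover have "y \<otimes> z \<notin> P" using P.I_prime y z zc by blast
    ultimately show ?case using y zc by (intro exI[of _ "y \<otimes> z"]) auto
  qed
  then show False using assms(4) by blast
qed

text \<open>Passing to proper subfamilies reduces to a cover with no redundant member. Then
  \<open>x \<oplus> y\<close> escapes it, where \<open>x\<close> avoids all members but
  \<open>P0\<close>, and \<open>y\<close> lies in all members but \<open>P0\<close>.\<close>

lemma (in cring) prime_avoidance:
  assumes "finite F" "\<And>P. P \<in> F \<Longrightarrow> primeideal P R" "ideal J R" "J \<subseteq> \<Union>F"
  shows "\<exists>P\<in>F. J \<subseteq> P"
  using assms(1,2,4)
proof (induction F rule: finite_psubset_induct)
  case (psubset F)
  interpret J: ideal J R by fact
  have IH: "\<exists>P\<in>F. J \<subseteq> P" if "G \<subset> F" "J \<subseteq> \<Union>G" for G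
    using psubset.IH[OF that(1)] psubset.prems that by blast
  obtain P0 where P0: "P0 \<in> F" using psubset.prems J.zero_closed by blast
  interpret P0: primeideal P0 R using P0 psubset.prems by blast
  show ?case
  proof (rule ccontr)
    assume n: "\<not> ?case"
    have nJ: "\<not> J \<subseteq> \<Union>(F - {P0})" using IH[of "F - {P0}"] n P0 by blast
    \<comment> \<open>A member inside \<open>P0\<close> could be dropped from the cover, against the
      induction hypothesis.\<close>
    have anti: "\<not> P \<subseteq> P0" if "P \<in> F - {P0}" for P
    proof
      assume "P \<subseteq> P0"
      then have "J \<subseteq> \<Union>(F - {P})" using psubset.prems that P0 by blast
      then show False using IH[of "F - {P}"] n that by blast
    qed
    obtain x where x: "x \<in> J" "x \<notin> \<Union>(F - {P0})" using nJ by blast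
    have xP0: "x \<in> P0" using x psubset.prems by blast
    \<comment> \<open>Were the intersection of \<open>J\<close> with the other primes inside
      \<open>P0\<close>, then \<open>J\<close> or one of these primes would be inside
      \<open>P0\<close>; both are excluded.\<close>
    have "\<not> carrier R \<inter> \<Inter>(insert J (F - {P0})) \<subseteq> P0"
    proof
      assume "carrier R \<inter> \<Inter>(insert J (F - {P0})) \<subseteq> P0"
      then have "\<exists>I\<in>insert J (F - {P0}). I \<subseteq> P0"
        using psubset.hyps psubset.prems assms(3)
        by (intro prime_contains_Inter) (auto simp: P0.primeideal_axioms dest: primeideal.axioms(1))
      then show False using anti n P0 by blast
    qed
    then obtain y where y: "y \<in> J" "y \<in> \<Inter>(F - {P0})" "y \<notin> P0" by blast
    have c: "x \<in> carrier R" "y \<in> carrier R" using x y by auto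
    have "x \<oplus> y \<in> J" using x y by simp
    then obtain P where P: "P \<in> F" "x \<oplus> y \<in> P" using psubset.prems by blast
    have I: "ideal P R" using P psubset.prems primeideal.axioms(1) by blast
    show False
    proof (cases "P = P0")
      case True
      then show ?thesis
        using mem_ideal_addD[OF I, of y x] P y xP0 c by (simp add: a_comm)
    next
      case False
      then show ?thesis using mem_ideal_addD[OF I, of x y] P x y c by blast
    qed
  qed
qed

text \<open>The ideal quotient \<open>(Q : y)\<close>, that is, the annihilator of the class of
  \<open>y\<close> in \<open>R/Q\<close>.\<close>

definition colon :: "('a, 'r) ring_scheme \<Rightarrow> 'a set \<Rightarrow> 'a \<Rightarrow> 'a set" where
  "colon R Q y = {a \<in> carrier R. a \<otimes>\<^bsub>R\<^esub> y \<in> Q}"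

lemma (in cring) colon_ideal:
  assumes "ideal Q R" "y \<in> carrier R"
  shows "ideal (colon R Q y) R"
proof -
  interpret Q: ideal Q R by fact
  show ?thesis
    using assms(2) by (intro idealI') (auto simp: colon_def l_distr m_assoc Q.I_l_closed)
qed

text \<open>This is the argument for associated primes: if \<open>b \<otimes> y\<close> is outside
  \<open>Q\<close>, then \<open>(Q : b y)\<close> contains \<open>(Q : y)\<close>, so the two agree
  by maximality, and \<open>a \<otimes> b \<in> (Q : y)\<close> says that \<open>a\<close> lies in
  the former.\<close>

lemma (in cring) maximal_colon_prime:
  assumes Q: "ideal Q R" and y: "y \<in> carrier R - Q"
    and max: "\<And>z. z \<in> carrier R - Q \<Longrightarrow> colon R Q y \<subseteq> colon R Q z \<Longrightarrow> colon R Q z = colon R Q y"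
  shows "primeideal (colon R Q y) R"
proof (rule primeidealI[OF colon_ideal[OF Q]])
  interpret Q: ideal Q R by fact
  have "\<one> \<notin> colon R Q y" using y by (simp add: colon_def)
  then show "carrier R \<noteq> colon R Q y" by blast
  fix a b assume ab: "a \<in> carrier R" "b \<in> carrier R" "a \<otimes> b \<in> colon R Q y"
  show "a \<in> colon R Q y \<or> b \<in> colon R Q y"
  proof (rule disjCI)
    assume b: "b \<notin> colon R Q y"
    have "c \<otimes> (b \<otimes> y) \<in> Q" if "c \<in> carrier R" "c \<otimes> y \<in> Q" for c
      using Q.I_l_closed[OF that(2) ab(2)] that ab y by (simp add: m_lcomm)
    then have "colon R Q (b \<otimes> y) = colon R Q y"
      using ab b y by (intro max) (auto simp: colon_def)
    moreover have "a \<in> colon R Q (b \<otimes> y)" using ab y by (auto simp: colon_def m_assoc)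
    ultimately show "a \<in> colon R Q y" by simp
  qed
qed (use y is_cring in auto)

text \<open>The maximal ideals of the form \<open>(Q : y)\<close> are prime, and by the ascending chain
  condition on the ideals generated by the elements \<open>y\<close> there are only finitely many of them.
  Prime avoidance then turns elementwise annihilation into uniform annihilation.\<close>

lemma (in cring) zero_divisor_ideal_annihilated:
  assumes "noetherian_ring R" and Q: "ideal Q R" and J: "ideal J R"
    and zd: "\<And>a. a \<in> J \<Longrightarrow> \<exists>y\<in>carrier R - Q. a \<otimes> y \<in> Q"
  shows "\<exists>y\<in>carrier R - Q. \<forall>a\<in>J. a \<otimes> y \<in> Q"
proof -
  interpret noetherian_ring R by fact
  interpret Q: ideal Q R by fact
  interpret J: ideal J R by fact
  let ?C = "colon R Q"
  define S where "S = {y \<in> carrier R - Q. \<forall>z\<in>carrier R - Q. ?C y \<subseteq> ?C z \<longrightarrow> ?C z = ?C y}"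
  have Sc: "S \<subseteq> carrier R" by (auto simp: S_def)
  have prime: "primeideal (?C y) R" if "y \<in> S" for y
    using that by (intro maximal_colon_prime[OF Q]) (auto simp: S_def)
  have cover: "\<exists>y\<in>S. a \<in> ?C y" if "a \<in> J" for a
  proof -
    obtain y where y: "y \<in> carrier R - Q" "a \<otimes> y \<in> Q" using zd[OF \<open>a \<in> J\<close>] by blast
    \<comment> \<open>The chain condition enlarges \<open>?C y\<close> to a maximal colon ideal,
      which still contains \<open>a\<close>.\<close>
    have "\<exists>I\<in>?C ` (carrier R - Q). ?C y \<subseteq> I \<and> (\<forall>K\<in>?C ` (carrier R - Q). I \<subseteq> K \<longrightarrow> K = I)"
      using y colon_ideal[OF Q] by (intro exists_maximal_above) auto
    then obtain z where "z \<in> carrier R - Q" "?C y \<subseteq> ?C z"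
        "\<forall>w\<in>carrier R - Q. ?C z \<subseteq> ?C w \<longrightarrow> ?C w = ?C z" by auto
    moreover have "a \<in> ?C y" using y that by (auto simp: colon_def)
    ultimately show ?thesis unfolding S_def by blast
  qed
  \<comment> \<open>A maximal ideal \<open>Idl T\<close> among those generated by finite subsets of
    \<open>S\<close> must contain all of \<open>S\<close>, since adjoining one more element does not
    enlarge it.\<close>
  let ?G = "genideal R ` {T. finite T \<and> T \<subseteq> S}"
  have "\<exists>I\<in>?G. Idl {} \<subseteq> I \<and> (\<forall>K\<in>?G. I \<subseteq> K \<longrightarrow> K = I)"
    using Sc by (intro exists_maximal_above) (auto intro!: genideal_ideal)
  then obtain T where T: "finite T" "T \<subseteq> S"
    and Tmax: "\<And>U. finite U \<Longrightarrow> U \<subseteq> S \<Longrightarrow> Idl T \<subseteq> Idl U \<Longrightarrow> Idl U = Idl T" by auto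
  have S_sub: "s \<in> Idl T" if s: "s \<in> S" for s
  proof -
    have c: "insert s T \<subseteq> carrier R" using T Sc s by blast
    have "Idl T \<subseteq> Idl (insert s T)" by (rule subset_Idl_subset[OF c]) blast
    then have "Idl (insert s T) = Idl T" using T s by (intro Tmax) auto
    then show ?thesis using genideal_self[OF c] by blast
  qed
  have "J \<subseteq> \<Union>(?C ` T)"
  proof
    fix a assume "a \<in> J"
    then obtain s where s: "s \<in> S" "a \<in> ?C s" using cover by blast
    \<comment> \<open>An element multiplying \<open>T\<close> into \<open>Q\<close> multiplies all
      of \<open>Idl T\<close> into \<open>Q\<close>, in particular \<open>s\<close>.\<close>
    have "carrier R \<inter> \<Inter>(?C ` T) \<subseteq> ?C s"
    proof
      fix c assume c: "c \<in> carrier R \<inter> \<Inter>(?C ` T)"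
      have "ideal {z \<in> carrier R. c \<otimes> z \<in> Q} R"
        using c by (intro idealI') (auto simp: r_distr m_lcomm Q.I_l_closed)
      moreover have "T \<subseteq> {z \<in> carrier R. c \<otimes> z \<in> Q}"
        using c T Sc by (auto simp: colon_def)
      ultimately have "Idl T \<subseteq> {z \<in> carrier R. c \<otimes> z \<in> Q}" by (rule genideal_minimal)
      then show "c \<in> ?C s" using S_sub[OF s(1)] c by (auto simp: colon_def)
    qed
    \<comment> \<open>The prime \<open>?C s\<close> thus contains some \<open>?C y\<close> with
      \<open>y \<in> T\<close>, and maximality of \<open>?C y\<close> makes them equal; so the
      finitely many primes from \<open>T\<close> cover \<open>J\<close>.\<close>
    then have "\<exists>I\<in>?C ` T. I \<subseteq> ?C s"
      using T colon_ideal[OF Q] Sc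
      by (intro prime_contains_Inter[OF _ prime[OF s(1)]]) auto
    then obtain y where y: "y \<in> T" "?C y \<subseteq> ?C s" by auto
    then have "?C s = ?C y" using s T by (auto simp: S_def)
    then show "a \<in> \<Union>(?C ` T)" using s y by auto
  qed
  then have "\<exists>P\<in>?C ` T. J \<subseteq> P"
    using T prime by (intro prime_avoidance[OF _ _ J]) auto
  then obtain y where "y \<in> T" "J \<subseteq> ?C y" by auto
  then show ?thesis using T by (auto simp: S_def colon_def)
qed

section \<open>Module homomorphisms\<close>

lemma regular_module_simps [simp]:
  "carrier (regular_module R) = carrier R" "\<zero>\<^bsub>regular_module R\<^esub> = \<zero>\<^bsub>R\<^esub>"
  "x \<oplus>\<^bsub>regular_module R\<^esub> y = x \<oplus>\<^bsub>R\<^esub> y" "a \<odot>\<^bsub>regular_module R\<^esub> x = a \<otimes>\<^bsub>R\<^esub> x"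
  by (simp_all add: regular_module_def)

lemma (in cring) module_regular_module: "module R (regular_module R)"
proof (rule moduleI)
  show "abelian_group (regular_module R)"
    by (rule abelian_groupI) (auto simp: a_ac intro: bexI[where x = "\<ominus> _"] l_neg r_neg)
qed (auto simp: is_cring l_distr r_distr m_assoc)

section \<open>Building homomorphisms and factoring them through surjections\<close>

lemma mod_homI:
  assumes "\<And>x. x \<in> carrier M \<Longrightarrow> f x \<in> carrier N" "f \<in> extensional (carrier M)"
    and "\<And>x y. x \<in> carrier M \<Longrightarrow> y \<in> carrier M \<Longrightarrow> f (x \<oplus>\<^bsub>M\<^esub> y) = f x \<oplus>\<^bsub>N\<^esub> f y"
    and "\<And>a x. a \<in> carrier R \<Longrightarrow> x \<in> carrier M \<Longrightarrow> f (a \<odot>\<^bsub>M\<^esub> x) = a \<odot>\<^bsub>N\<^esub> f x"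
  shows "f \<in> mod_hom R M N"
  using assms by (auto simp: mod_hom_def PiE_iff)

lemma mod_homD:
  assumes "f \<in> mod_hom R M N"
  shows "x \<in> carrier M \<Longrightarrow> f x \<in> carrier N"
    and "f \<in> extensional (carrier M)"
    and "x \<in> carrier M \<Longrightarrow> y \<in> carrier M \<Longrightarrow> f (x \<oplus>\<^bsub>M\<^esub> y) = f x \<oplus>\<^bsub>N\<^esub> f y"
    and "a \<in> carrier R \<Longrightarrow> x \<in> carrier M \<Longrightarrow> f (a \<odot>\<^bsub>M\<^esub> x) = a \<odot>\<^bsub>N\<^esub> f x"
  using assms by (auto simp: mod_hom_def PiE_iff)

lemma mod_hom_zero:
  assumes "module R M" "module R N" "f \<in> mod_hom R M N"
  shows "f \<zero>\<^bsub>M\<^esub> = \<zero>\<^bsub>N\<^esub>"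
proof -
  interpret M: module R M by fact
  interpret N: module R N by fact
  show ?thesis
    using mod_homD(4)[OF assms(3) M.R.zero_closed M.M.zero_closed]
      mod_homD(1)[OF assms(3) M.M.zero_closed] by simp
qed

lemma mod_hom_compose:
  assumes "module R L" "p \<in> mod_hom R L M" "f \<in> mod_hom R M N"
  shows "(\<lambda>x\<in>carrier L. f (p x)) \<in> mod_hom R L N"
proof -
  interpret L: module R L by fact
  note D = mod_homD(1,3,4)[OF assms(2)] mod_homD(1,3,4)[OF assms(3)]
  show ?thesis by (rule mod_homI) (auto simp: D)
qed

lemma (in cring) minus_mult_add:
  assumes "a \<in> carrier R" "b \<in> carrier R" "c \<in> carrier R" "d \<in> carrier R" "x \<in> carrier R"
  shows "(a \<oplus> b) \<ominus> x \<otimes> (c \<oplus> d) = (a \<ominus> x \<otimes> c) \<oplus> (b \<ominus> x \<otimes> d)"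
  using assms by algebra

lemma (in cring) minus_mult_mult:
  assumes "a \<in> carrier R" "c \<in> carrier R" "x \<in> carrier R" "y \<in> carrier R"
  shows "y \<otimes> a \<ominus> x \<otimes> (y \<otimes> c) = y \<otimes> (a \<ominus> x \<otimes> c)"
  using assms by algebra

lemma mod_hom_diff_smult:
  assumes "module R M" "f \<in> mod_hom R M (regular_module R)" "g \<in> mod_hom R M (regular_module R)"
    and "c \<in> carrier R"
  shows "(\<lambda>x\<in>carrier M. f x \<ominus>\<^bsub>R\<^esub> c \<otimes>\<^bsub>R\<^esub> g x) \<in> mod_hom R M (regular_module R)"
proof -
  interpret M: module R M by fact
  note f = mod_homD[OF assms(2), simplified] and g = mod_homD[OF assms(3), simplified]
  show ?thesis
    using assms(4) f(1) g(1)
    by (intro mod_homI) (auto simp: f(3,4) g(3,4) M.R.minus_mult_add M.R.minus_mult_mult)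
qed

text \<open>The value at \<open>m\<close> is \<open>u\<close> of any preimage of \<open>m\<close>;
  two preimages differ by an element of the kernel of \<open>p\<close>, on which \<open>u\<close>
  vanishes. It serves to descend functionals from \<open>res_term R M 0\<close> to
  \<open>M\<close>.\<close>

lemma mod_hom_factor_surj:
  assumes L: "module R L" and M: "module R M" and N: "module R N"
    and p: "p \<in> mod_hom R L M" and surj: "p ` carrier L = carrier M"
    and u: "u \<in> mod_hom R L N"
    and ker: "\<And>x. x \<in> carrier L \<Longrightarrow> p x = \<zero>\<^bsub>M\<^esub> \<Longrightarrow> u x = \<zero>\<^bsub>N\<^esub>"
  shows "\<exists>g\<in>mod_hom R M N. \<forall>x\<in>carrier L. g (p x) = u x"
proof -
  interpret L: module R L by fact
  interpret M: module R M by fact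
  interpret N: module R N by fact
  note pD = mod_homD[OF p] and uD = mod_homD[OF u]
  have wd: "u x = u y" if "x \<in> carrier L" "y \<in> carrier L" "p x = p y" for x y
  proof -
    let ?m = "\<ominus>\<^bsub>R\<^esub> \<one>\<^bsub>R\<^esub>"
    have "p (x \<oplus>\<^bsub>L\<^esub> ?m \<odot>\<^bsub>L\<^esub> y) = \<zero>\<^bsub>M\<^esub>"
      using that pD(1)[of y] by (simp add: pD(3,4) M.smult_l_minus M.M.r_neg)
    then have "u (x \<oplus>\<^bsub>L\<^esub> ?m \<odot>\<^bsub>L\<^esub> y) = \<zero>\<^bsub>N\<^esub>" using that by (intro ker) auto
    then have "u x \<oplus>\<^bsub>N\<^esub> \<ominus>\<^bsub>N\<^esub> u y = \<zero>\<^bsub>N\<^esub>"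
      using that uD(1)[of y] by (simp add: uD(3,4) N.smult_l_minus)
    then show ?thesis using uD(1)[OF that(1)] uD(1)[OF that(2)]
      by (metis N.M.add.inv_closed N.M.minus_equality N.M.minus_minus)
  qed
  define g where "g = (\<lambda>m\<in>carrier M. u (SOME x. x \<in> carrier L \<and> p x = m))"
  have g: "g (p x) = u x" if "x \<in> carrier L" for x
  proof -
    have "(SOME y. y \<in> carrier L \<and> p y = p x) \<in> carrier L \<and>
        p (SOME y. y \<in> carrier L \<and> p y = p x) = p x"
      by (rule someI[of _ x]) (simp add: that)
    then show ?thesis using wd[OF _ that] pD(1)[OF that] by (simp add: g_def)
  qed
  have ex: "\<exists>x\<in>carrier L. m = p x" if "m \<in> carrier M" for m
    using that unfolding surj[symmetric] by auto
  have "g \<in> mod_hom R M N"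
  proof (rule mod_homI)
    show "g \<in> extensional (carrier M)" by (simp add: g_def)
    show "g m \<in> carrier N" if m: "m \<in> carrier M" for m
    proof -
      obtain x where "x \<in> carrier L" "m = p x" using ex m by metis
      then show ?thesis using g uD(1) by simp
    qed
    show "g (m \<oplus>\<^bsub>M\<^esub> n) = g m \<oplus>\<^bsub>N\<^esub> g n" if m: "m \<in> carrier M" "n \<in> carrier M" for m n
    proof -
      obtain x y where "x \<in> carrier L" "m = p x" "y \<in> carrier L" "n = p y"
        using ex m by metis
      then show ?thesis using g[of "x \<oplus>\<^bsub>L\<^esub> y"] by (simp add: g pD(3) uD(3))
    qed
    show "g (a \<odot>\<^bsub>M\<^esub> m) = a \<odot>\<^bsub>N\<^esub> g m" if m: "a \<in> carrier R" "m \<in> carrier M" for a m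
    proof -
      obtain x where "x \<in> carrier L" "m = p x" using ex m by metis
      then show ?thesis using m g[of "a \<odot>\<^bsub>L\<^esub> x"] by (simp add: g pD(4) uD(4))
    qed
  qed
  then show ?thesis using g by blast
qed

section \<open>Functionals on free modules\<close>

definition unit_vector :: "('a, 'r) ring_scheme \<Rightarrow> 'b \<Rightarrow> 'b \<Rightarrow> 'a" where
  "unit_vector R b = (\<lambda>c. if c = b then \<one>\<^bsub>R\<^esub> else \<zero>\<^bsub>R\<^esub>)"

lemma (in cring) unit_vector_closed:
  assumes "b \<in> B"
  shows "unit_vector R b \<in> carrier (free_module R B)"
proof -
  have sub: "{c. unit_vector R b c \<noteq> \<zero>} \<subseteq> {b}" by (auto simp: unit_vector_def)
  show ?thesis
    using assms finite_subset[OF sub] by (auto simp: free_module_simps unit_vector_def)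
qed

lemma linear_extension_unit_vector:
  assumes "module R M" "g \<in> B \<rightarrow> carrier M" "b \<in> B"
  shows "linear_extension R B M g (unit_vector R b) = g b"
proof -
  interpret module R M by fact
  have gb: "g b \<in> carrier M" using assms by auto
  have e: "unit_vector R b \<in> carrier (free_module R B)" by (rule R.unit_vector_closed) fact
  show ?thesis
  proof (cases "\<one>\<^bsub>R\<^esub> = \<zero>\<^bsub>R\<^esub>")
    \<comment> \<open>In the zero ring the unit vector has empty support, so both sides are
      zero.\<close>
    case True
    then have "g b = \<zero>\<^bsub>M\<^esub>" using gb smult_one[OF gb] by simp
    moreover have "{c. unit_vector R b c \<noteq> \<zero>\<^bsub>R\<^esub>} = {}" using True by (auto simp: unit_vector_def)
    ultimately show ?thesis using e by (simp add: linear_extension_def)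
  next
    case False
    then have "{c. unit_vector R b c \<noteq> \<zero>\<^bsub>R\<^esub>} = {b}" by (auto simp: unit_vector_def)
    then show ?thesis using e gb by (simp add: linear_extension_def unit_vector_def)
  qed
qed

text \<open>Membership in \<open>I\<close> passes from the basis to all vectors by removing one
  coordinate of the finite support at a time. Congruences of functionals modulo \<open>I\<close> can
  thus be checked on unit vectors.\<close>

lemma (in cring) hom_free_module_in_ideal:
  assumes q: "q \<in> mod_hom R (free_module R B) (regular_module R)" and I: "ideal I R"
    and b: "\<And>b. b \<in> B \<Longrightarrow> q (unit_vector R b) \<in> I" and v: "v \<in> carrier (free_module R B)"
  shows "q v \<in> I"
proof -
  interpret I: ideal I R by fact
  interpret F: module R "free_module R B" by (rule module_free_module) (rule is_cring)
  note qD = mod_homD[OF q, simplified]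
  have "q v \<in> I" if "finite S" "S \<subseteq> B" "v \<in> carrier (free_module R B)" "{b. v b \<noteq> \<zero>} \<subseteq> S" for S v
    using that
  proof (induction S arbitrary: v rule: finite_induct)
    case empty
    then have "v = \<zero>\<^bsub>free_module R B\<^esub>" by (auto simp: free_module_simps)
    then show ?case using mod_hom_zero[OF F.module_axioms module_regular_module q] by simp
  next
    case (insert b S)
    let ?w = "v(b := \<zero>)"
    have w: "?w \<in> carrier (free_module R B)"
    proof -
      have "{c. ?w c \<noteq> \<zero>} = {c. v c \<noteq> \<zero>} - {b}" by auto
      then show ?thesis using insert.prems by (auto simp: free_module_simps)
    qed
    have vc: "v c \<in> carrier R" for c using insert.prems by (simp add: free_module_simps)
    have e: "unit_vector R b \<in> carrier (free_module R B)"
      using insert.prems by (intro unit_vector_closed) auto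
    have "v = ?w \<oplus>\<^bsub>free_module R B\<^esub> v b \<odot>\<^bsub>free_module R B\<^esub> unit_vector R b"
      using vc by (auto simp: free_module_simps unit_vector_def fun_eq_iff)
    then have "q v = q ?w \<oplus> v b \<otimes> q (unit_vector R b)"
      using qD(3)[OF w F.smult_closed[OF vc e]] qD(4)[OF vc e] by metis
    moreover have "q ?w \<in> I" using insert.prems by (intro insert.IH[OF _ w]) auto
    moreover have "v b \<otimes> q (unit_vector R b) \<in> I"
      using b insert.prems vc by (auto intro: I.I_l_closed)
    ultimately show ?case by simp
  qed
  from this[of "{b. v b \<noteq> \<zero>}" v] show ?thesis using v by (auto simp: free_module_simps)
qed

text \<open>Here freeness replaces projectivity: the quotients \<open>c\<close> are chosen on the
  basis only and extended linearly, which makes the division of \<open>f\<close> by \<open>x\<close>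
  modulo \<open>I\<close> linear.\<close>

lemma (in cring) hom_free_module_split:
  assumes f: "f \<in> mod_hom R (free_module R B) (regular_module R)" and I: "ideal I R"
    and x: "x \<in> carrier R"
    and v: "\<And>v. v \<in> carrier (free_module R B) \<Longrightarrow> \<exists>c\<in>carrier R. f v \<ominus> x \<otimes> c \<in> I"
  shows "\<exists>h\<in>mod_hom R (free_module R B) (regular_module R).
    \<forall>v\<in>carrier (free_module R B). f v \<ominus> x \<otimes> h v \<in> I"
proof -
  interpret F: module R "free_module R B" by (rule module_free_module) (rule is_cring)
  obtain c where c: "\<And>b. b \<in> B \<Longrightarrow> c b \<in> carrier R \<and> f (unit_vector R b) \<ominus> x \<otimes> c b \<in> I"
    using v[OF unit_vector_closed] by metis
  define h where "h = linear_extension R B (regular_module R) c"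
  have cB: "c \<in> B \<rightarrow> carrier (regular_module R)" using c by auto
  have h: "h \<in> mod_hom R (free_module R B) (regular_module R)"
    unfolding h_def by (rule linear_extension_hom[OF module_regular_module cB])
  let ?q = "\<lambda>v\<in>carrier (free_module R B). f v \<ominus> x \<otimes> h v"
  have q: "?q \<in> mod_hom R (free_module R B) (regular_module R)"
    by (rule mod_hom_diff_smult[OF F.module_axioms f h x])
  have "?q v \<in> I" if "v \<in> carrier (free_module R B)" for v
  proof (rule hom_free_module_in_ideal[OF q I _ that])
    fix b assume b: "b \<in> B"
    then show "?q (unit_vector R b) \<in> I"
      using c[OF b] linear_extension_unit_vector[OF module_regular_module cB b] unit_vector_closed[OF b]
      by (simp add: h_def)
  qed
  then show ?thesis using h by auto
qed

text \<open>The elements of this form make up the ideal \<open>xR + Idl A\<close>, which contains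
  all generators.\<close>

lemma (in cring) genideal_insertD:
  assumes A: "A \<subseteq> carrier R" and x: "x \<in> carrier R" and a: "a \<in> Idl (insert x A)"
  shows "\<exists>c\<in>carrier R. a \<ominus> x \<otimes> c \<in> Idl A"
proof -
  interpret I: ideal "Idl A" R by (rule genideal_ideal[OF A])
  let ?J = "{a \<in> carrier R. \<exists>c\<in>carrier R. a \<ominus> x \<otimes> c \<in> Idl A}"
  have J: "ideal ?J R"
  proof (rule idealI')
    show "\<zero> \<in> ?J" using x by (auto intro!: bexI[of _ \<zero>] simp: minus_eq)
  next
    fix a b assume "a \<in> ?J" "b \<in> ?J"
    then obtain c d where c: "a \<in> carrier R" "c \<in> carrier R" "a \<ominus> x \<otimes> c \<in> Idl A"
      and d: "b \<in> carrier R" "d \<in> carrier R" "b \<ominus> x \<otimes> d \<in> Idl A" by auto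
    then show "a \<oplus> b \<in> ?J" using x by (auto simp: minus_mult_add intro!: bexI[of _ "c \<oplus> d"])
  next
    fix a y assume "a \<in> ?J" and y: "y \<in> carrier R"
    then obtain c where c: "a \<in> carrier R" "c \<in> carrier R" "a \<ominus> x \<otimes> c \<in> Idl A" by auto
    then show "y \<otimes> a \<in> ?J" using x y I.I_l_closed by (auto simp: minus_mult_mult intro!: bexI[of _ "y \<otimes> c"])
  qed auto
  have "x \<ominus> x \<otimes> \<one> = \<zero>" using x by algebra
  then have "x \<ominus> x \<otimes> \<one> \<in> Idl A" by simp
  then have "x \<in> ?J" using x one_closed by blast
  moreover have "a \<in> ?J" if "a \<in> A" for a
  proof -
    have "a \<ominus> x \<otimes> \<zero> = a" using that A x by (auto simp: minus_eq)
    then show ?thesis using that A genideal_self[OF A] by (auto intro!: bexI[of _ \<zero>])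
  qed
  ultimately have "Idl (insert x A) \<subseteq> ?J" using J by (intro genideal_minimal) auto
  then show ?thesis using a by blast
qed

section \<open>Free rank one summands\<close>

lemma module_dual_module:
  assumes "module R M"
  shows "module R (dual_module R M)"
proof -
  interpret M: module R M by fact
  let ?D = "dual_module R M"
  have D: "carrier ?D = mod_hom R M (regular_module R)"
    "\<And>f g. f \<oplus>\<^bsub>?D\<^esub> g = (\<lambda>x\<in>carrier M. f x \<oplus>\<^bsub>R\<^esub> g x)"
    "\<And>a f. a \<odot>\<^bsub>?D\<^esub> f = (\<lambda>x\<in>carrier M. a \<otimes>\<^bsub>R\<^esub> f x)"
    "\<zero>\<^bsub>?D\<^esub> = (\<lambda>x\<in>carrier M. \<zero>\<^bsub>R\<^esub>)"
    by (simp_all add: dual_module_def Hom_module_def)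
  note hD = mod_homD(1,3,4)[where N = "regular_module R", simplified]
  have ext: "f = g" if "f \<in> mod_hom R M (regular_module R)" "g \<in> mod_hom R M (regular_module R)"
    "\<And>x. x \<in> carrier M \<Longrightarrow> f x = g x" for f g
    using that mod_homD(2) by (metis extensionalityI)
  have add: "(\<lambda>x\<in>carrier M. f x \<oplus>\<^bsub>R\<^esub> g x) \<in> mod_hom R M (regular_module R)"
    if "f \<in> mod_hom R M (regular_module R)" "g \<in> mod_hom R M (regular_module R)" for f g
    using hD[OF that(1)] hD[OF that(2)]
    by (intro mod_homI) (auto simp: M.R.a_ac M.R.r_distr)
  have smult: "(\<lambda>x\<in>carrier M. a \<otimes>\<^bsub>R\<^esub> f x) \<in> mod_hom R M (regular_module R)"
    if "a \<in> carrier R" "f \<in> mod_hom R M (regular_module R)" for a f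
    using that(1) hD[OF that(2)]
    by (intro mod_homI) (auto simp: M.R.m_lcomm M.R.r_distr)
  have zero: "(\<lambda>x\<in>carrier M. \<zero>\<^bsub>R\<^esub>) \<in> mod_hom R M (regular_module R)"
    by (intro mod_homI) auto
  have neg: "\<exists>g\<in>mod_hom R M (regular_module R). (\<lambda>x\<in>carrier M. g x \<oplus>\<^bsub>R\<^esub> f x) = (\<lambda>x\<in>carrier M. \<zero>\<^bsub>R\<^esub>)"
    if f: "f \<in> mod_hom R M (regular_module R)" for f
    using hD(1)[OF f]
    by (intro bexI[OF _ smult[OF _ f, of "\<ominus>\<^bsub>R\<^esub> \<one>\<^bsub>R\<^esub>"]])
      (auto simp: fun_eq_iff restrict_def M.R.l_minus M.R.l_neg)
  show ?thesis
  proof (rule moduleI)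
    show "abelian_group ?D"
    proof (rule abelian_groupI)
      fix f g h assume "f \<in> carrier ?D" "g \<in> carrier ?D" "h \<in> carrier ?D"
      then show "f \<oplus>\<^bsub>?D\<^esub> g \<oplus>\<^bsub>?D\<^esub> h = f \<oplus>\<^bsub>?D\<^esub> (g \<oplus>\<^bsub>?D\<^esub> h)"
        unfolding D by (intro ext add) (auto simp: M.R.a_assoc hD(1))
    next
      fix f g assume "f \<in> carrier ?D" "g \<in> carrier ?D"
      then show "f \<oplus>\<^bsub>?D\<^esub> g = g \<oplus>\<^bsub>?D\<^esub> f"
        unfolding D by (intro ext add) (auto simp: M.R.a_comm hD(1))
    next
      fix f assume "f \<in> carrier ?D"
      then show "\<zero>\<^bsub>?D\<^esub> \<oplus>\<^bsub>?D\<^esub> f = f"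
        unfolding D by (intro ext add zero) (auto simp: hD(1))
    qed (use add neg zero in \<open>auto simp: D\<close>)
  next
    fix a f g assume "a \<in> carrier R" "f \<in> carrier ?D" "g \<in> carrier ?D"
    then show "a \<odot>\<^bsub>?D\<^esub> (f \<oplus>\<^bsub>?D\<^esub> g) = a \<odot>\<^bsub>?D\<^esub> f \<oplus>\<^bsub>?D\<^esub> a \<odot>\<^bsub>?D\<^esub> g"
      unfolding D by (intro ext add smult) (auto simp: M.R.r_distr hD(1))
  next
    fix a b f assume "a \<in> carrier R" "b \<in> carrier R" "f \<in> carrier ?D"
    then show "(a \<oplus>\<^bsub>R\<^esub> b) \<odot>\<^bsub>?D\<^esub> f = a \<odot>\<^bsub>?D\<^esub> f \<oplus>\<^bsub>?D\<^esub> b \<odot>\<^bsub>?D\<^esub> f"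
      "a \<otimes>\<^bsub>R\<^esub> b \<odot>\<^bsub>?D\<^esub> f = a \<odot>\<^bsub>?D\<^esub> (b \<odot>\<^bsub>?D\<^esub> f)"
      unfolding D by (intro ext add smult; auto simp: M.R.l_distr M.R.m_assoc hD(1))+
  next
    fix f assume "f \<in> carrier ?D"
    then show "\<one>\<^bsub>R\<^esub> \<odot>\<^bsub>?D\<^esub> f = f"
      unfolding D by (intro ext smult) (auto simp: hD(1))
  qed (use smult in \<open>auto simp: D M.R.is_cring\<close>)
qed

text \<open>The functional is the projection onto \<open>A\<close> along \<open>B\<close> followed
  by the inverse of \<open>\<theta>\<close>; it takes the value one at
  \<open>\<theta> \<one>\<close>.\<close>

lemma direct_summand_regular_imp_functional:
  assumes "module R M" "direct_summand R (regular_module R) M"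
  shows "\<exists>\<phi>\<in>mod_hom R M (regular_module R). \<exists>z\<in>carrier M. \<phi> z = \<one>\<^bsub>R\<^esub>"
proof -
  interpret M: module R M by fact
  obtain A B \<theta> where A: "submodule A R M" and B: "submodule B R M"
    and sum: "A <+>\<^bsub>M\<^esub> B = carrier M" and int: "A \<inter> B = {\<zero>\<^bsub>M\<^esub>}"
    and \<theta>: "\<theta> \<in> mod_hom R (regular_module R) (M\<lparr>carrier := A\<rparr>)"
    and bij: "bij_betw \<theta> (carrier R) A"
    using assms(2) by (auto simp: direct_summand_def module_isomorphic_def)
  note AE = M.submoduleE[OF A] and BE = M.submoduleE[OF B]
  note \<theta>D = mod_homD[OF \<theta>, simplified]
  have Mc: "x \<in> carrier M" if "x \<in> A \<or> x \<in> B" for x using that AE(1) BE(1) by blast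
  have ex: "\<exists>r\<in>carrier R. \<exists>b\<in>B. x = \<theta> r \<oplus>\<^bsub>M\<^esub> b" if "x \<in> carrier M" for x
  proof -
    have "x \<in> A <+>\<^bsub>M\<^esub> B" using sum that by simp
    then obtain a b where "a \<in> A" "b \<in> B" "x = a \<oplus>\<^bsub>M\<^esub> b" by (auto simp: set_add_def')
    moreover obtain r where "r \<in> carrier R" "a = \<theta> r"
      using bij \<open>a \<in> A\<close> by (auto simp: bij_betw_def)
    ultimately show ?thesis by auto
  qed
  have uniq: "r = s" if r: "r \<in> carrier R" and s: "s \<in> carrier R" and b: "b \<in> B" and c: "c \<in> B"
    and eq: "\<theta> r \<oplus>\<^bsub>M\<^esub> b = \<theta> s \<oplus>\<^bsub>M\<^esub> c" for r s b c
  proof -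
    have cl: "\<theta> r \<in> carrier M" "\<theta> s \<in> carrier M" "b \<in> carrier M" "c \<in> carrier M"
      using Mc \<theta>D(1) r s b c by auto
    \<comment> \<open>The difference of the two \<open>A\<close>-components is also a difference of
      \<open>B\<close>-components, hence zero.\<close>
    have "\<theta> r = \<theta> s \<oplus>\<^bsub>M\<^esub> (c \<oplus>\<^bsub>M\<^esub> \<ominus>\<^bsub>M\<^esub> b)"
      using eq cl by (metis M.M.a_assoc M.M.add.inv_closed M.M.add.inv_solve_right M.M.add.m_closed)
    then have "\<ominus>\<^bsub>M\<^esub> \<theta> s \<oplus>\<^bsub>M\<^esub> \<theta> r = c \<oplus>\<^bsub>M\<^esub> \<ominus>\<^bsub>M\<^esub> b"
      using cl by (simp add: M.M.r_neg1)
    moreover have "\<ominus>\<^bsub>M\<^esub> \<theta> s \<oplus>\<^bsub>M\<^esub> \<theta> r \<in> A" using AE(3,5) \<theta>D(1) r s by simp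
    moreover have "c \<oplus>\<^bsub>M\<^esub> \<ominus>\<^bsub>M\<^esub> b \<in> B" using BE(3,5) b c by simp
    ultimately have "c \<oplus>\<^bsub>M\<^esub> \<ominus>\<^bsub>M\<^esub> b = \<zero>\<^bsub>M\<^esub>" using int by auto
    then have "\<theta> r = \<theta> s" using \<open>\<theta> r = _\<close> cl by simp
    then show ?thesis using bij r s by (auto simp: bij_betw_def inj_on_def)
  qed
  define \<phi> where "\<phi> = (\<lambda>x\<in>carrier M. THE r. r \<in> carrier R \<and> (\<exists>b\<in>B. x = \<theta> r \<oplus>\<^bsub>M\<^esub> b))"
  have \<phi>: "\<phi> (\<theta> r \<oplus>\<^bsub>M\<^esub> b) = r" if r: "r \<in> carrier R" and b: "b \<in> B" for r b
  proof -
    have "\<theta> r \<oplus>\<^bsub>M\<^esub> b \<in> carrier M" using Mc \<theta>D(1) r b by auto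
    then show ?thesis unfolding \<phi>_def using r b by (auto intro!: the_equality dest: uniq)
  qed
  have 0: "\<zero>\<^bsub>M\<^esub> \<in> B" using int by auto
  have "\<phi> \<in> mod_hom R M (regular_module R)"
  proof (rule mod_homI)
    show "\<phi> x \<in> carrier (regular_module R)" if x: "x \<in> carrier M" for x
      using ex[OF x] \<phi> by auto
    show "\<phi> \<in> extensional (carrier M)" by (simp add: \<phi>_def)
    fix x assume x: "x \<in> carrier M"
    obtain r b where r: "r \<in> carrier R" "b \<in> B" "x = \<theta> r \<oplus>\<^bsub>M\<^esub> b" using ex[OF x] by auto
    have rc: "\<theta> r \<in> carrier M" "b \<in> carrier M" using Mc \<theta>D(1) r by auto
    show "\<phi> (a \<odot>\<^bsub>M\<^esub> x) = a \<odot>\<^bsub>regular_module R\<^esub> \<phi> x" if a: "a \<in> carrier R" for a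
    proof -
      have "a \<odot>\<^bsub>M\<^esub> x = \<theta> (a \<otimes>\<^bsub>R\<^esub> r) \<oplus>\<^bsub>M\<^esub> a \<odot>\<^bsub>M\<^esub> b"
        using a r rc by (simp add: \<theta>D(4) M.smult_r_distr)
      then show ?thesis using a r \<phi>[of "a \<otimes>\<^bsub>R\<^esub> r" "a \<odot>\<^bsub>M\<^esub> b"] BE(4) \<phi> by simp
    qed
    fix y assume y: "y \<in> carrier M"
    obtain s c where s: "s \<in> carrier R" "c \<in> B" "y = \<theta> s \<oplus>\<^bsub>M\<^esub> c" using ex[OF y] by auto
    have sc: "\<theta> s \<in> carrier M" "c \<in> carrier M" using Mc \<theta>D(1) s by auto
    have "x \<oplus>\<^bsub>M\<^esub> y = \<theta> (r \<oplus>\<^bsub>R\<^esub> s) \<oplus>\<^bsub>M\<^esub> (b \<oplus>\<^bsub>M\<^esub> c)"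
      using r s rc sc by (simp add: \<theta>D(3) M.M.a_ac)
    then show "\<phi> (x \<oplus>\<^bsub>M\<^esub> y) = \<phi> x \<oplus>\<^bsub>regular_module R\<^esub> \<phi> y"
      using r s \<phi>[of "r \<oplus>\<^bsub>R\<^esub> s" "b \<oplus>\<^bsub>M\<^esub> c"] BE(5) \<phi> by simp
  qed
  moreover have "\<phi> (\<theta> \<one>\<^bsub>R\<^esub> \<oplus>\<^bsub>M\<^esub> \<zero>\<^bsub>M\<^esub>) = \<one>\<^bsub>R\<^esub>" using \<phi> 0 by simp
  moreover have "\<theta> \<one>\<^bsub>R\<^esub> \<oplus>\<^bsub>M\<^esub> \<zero>\<^bsub>M\<^esub> \<in> carrier M" using Mc \<theta>D(1) by auto
  ultimately show ?thesis by blast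
qed

text \<open>The map \<open>a \<mapsto> a z\<close> is a section of \<open>f\<close>, so
  \<open>M\<close> is the direct sum of \<open>Rz\<close> and the kernel of \<open>f\<close>, via
  \<open>x = f(x) z + (x - f(x) z)\<close>.\<close>

lemma functional_imp_direct_summand_regular:
  assumes "module R M" and f: "f \<in> mod_hom R M (regular_module R)"
    and z: "z \<in> carrier M" "f z = \<one>\<^bsub>R\<^esub>"
  shows "direct_summand R (regular_module R) M"
proof -
  interpret M: module R M by fact
  note fD = mod_homD[OF f, simplified]
  have f0: "f \<zero>\<^bsub>M\<^esub> = \<zero>\<^bsub>R\<^esub>"
    using mod_hom_zero[OF assms(1) M.R.module_regular_module f] by simp
  have fneg: "f (\<ominus>\<^bsub>M\<^esub> x) = \<ominus>\<^bsub>R\<^esub> f x" if "x \<in> carrier M" for x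
    using fD(4)[of "\<ominus>\<^bsub>R\<^esub> \<one>\<^bsub>R\<^esub>" x] that fD(1)[OF that] by (simp add: M.smult_l_minus M.R.l_minus)
  let ?A = "(\<lambda>a. a \<odot>\<^bsub>M\<^esub> z) ` carrier R" and ?B = "{x \<in> carrier M. f x = \<zero>\<^bsub>R\<^esub>}"
  have A: "submodule ?A R M"
  proof (rule M.submoduleI)
    show "\<zero>\<^bsub>M\<^esub> \<in> ?A" using z by (intro image_eqI[of _ _ "\<zero>\<^bsub>R\<^esub>"]) auto
    show "\<ominus>\<^bsub>M\<^esub> x \<in> ?A" if "x \<in> ?A" for x
      using that z by (auto simp flip: M.smult_l_minus)
    show "x \<oplus>\<^bsub>M\<^esub> y \<in> ?A" if "x \<in> ?A" "y \<in> ?A" for x y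
      using that z by (auto simp flip: M.smult_l_distr)
    show "a \<odot>\<^bsub>M\<^esub> x \<in> ?A" if "a \<in> carrier R" "x \<in> ?A" for a x
      using that z by (auto simp flip: M.smult_assoc1)
  qed (use z in auto)
  have B: "submodule ?B R M"
    by (rule M.submoduleI) (auto simp: f0 fneg fD(3,4))
  have sum: "?A <+>\<^bsub>M\<^esub> ?B = carrier M"
  proof (intro equalityI subsetI)
    fix x assume x: "x \<in> carrier M"
    let ?y = "\<ominus>\<^bsub>M\<^esub> (f x \<odot>\<^bsub>M\<^esub> z)"
    have c: "f x \<odot>\<^bsub>M\<^esub> z \<in> carrier M" "?y \<in> carrier M" using fD(1)[OF x] z by auto
    have "f (x \<oplus>\<^bsub>M\<^esub> ?y) = \<zero>\<^bsub>R\<^esub>"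
      using x c z fD(1)[OF x] by (simp add: fD(3,4) fneg M.R.r_neg)
    moreover have "x = f x \<odot>\<^bsub>M\<^esub> z \<oplus>\<^bsub>M\<^esub> (x \<oplus>\<^bsub>M\<^esub> ?y)"
      using x c by (metis M.M.a_assoc M.M.a_comm M.M.l_zero M.M.r_neg)
    moreover have "f x \<odot>\<^bsub>M\<^esub> z \<in> ?A" using fD(1)[OF x] by blast
    ultimately show "x \<in> ?A <+>\<^bsub>M\<^esub> ?B" unfolding set_add_def' using x c by blast
  qed (use z in \<open>auto simp: set_add_def'\<close>)
  have int: "?A \<inter> ?B = {\<zero>\<^bsub>M\<^esub>}"
    using z f0 by (auto simp: fD(4) intro!: image_eqI[of _ _ "\<zero>\<^bsub>R\<^esub>"])
  have "(\<lambda>a\<in>carrier R. a \<odot>\<^bsub>M\<^esub> z) \<in> mod_hom R (regular_module R) (M\<lparr>carrier := ?A\<rparr>)"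
    using z by (intro mod_homI) (auto simp: M.smult_l_distr M.smult_assoc1)
  moreover have "bij_betw (\<lambda>a\<in>carrier R. a \<odot>\<^bsub>M\<^esub> z) (carrier R) ?A"
    unfolding bij_betw_def
  proof
    show "inj_on (\<lambda>a\<in>carrier R. a \<odot>\<^bsub>M\<^esub> z) (carrier R)"
    proof (rule inj_onI)
      fix a b assume ab: "a \<in> carrier R" "b \<in> carrier R"
        "(\<lambda>a\<in>carrier R. a \<odot>\<^bsub>M\<^esub> z) a = (\<lambda>a\<in>carrier R. a \<odot>\<^bsub>M\<^esub> z) b"
      then have "f (a \<odot>\<^bsub>M\<^esub> z) = f (b \<odot>\<^bsub>M\<^esub> z)" by simp
      then show "a = b" using ab z by (simp add: fD(4))
    qed
  qed auto
  ultimately have "module_isomorphic R (regular_module R) (M\<lparr>carrier := ?A\<rparr>)"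
    unfolding module_isomorphic_def
    by (intro bexI[of _ "\<lambda>a\<in>carrier R. a \<odot>\<^bsub>M\<^esub> z"]) auto
  then show ?thesis unfolding direct_summand_def using A B sum int by blast
qed

section \<open>Regular sequences and depth of the ring\<close>

lemma (in cring) submodule_regular_iff: "submodule H R (regular_module R) \<longleftrightarrow> ideal H R"
proof
  interpret M: module R "regular_module R" by (rule module_regular_module)
  assume H: "submodule H R (regular_module R)"
  note E = M.submoduleE[OF H, simplified]
  obtain h where "h \<in> H" using E(2) by blast
  then have "\<zero> \<in> H" using E(1) E(4)[of \<zero> h] by auto
  then show "ideal H R" using E by (intro idealI') auto
next
  interpret M: module R "regular_module R" by (rule module_regular_module)
  assume "ideal H R"
  then interpret H: ideal H R .
  have neg: "\<ominus>\<^bsub>regular_module R\<^esub> a = \<ominus> a" if "a \<in> carrier R" for a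
    using that by (intro M.M.minus_equality) (auto simp: l_neg)
  show "submodule H R (regular_module R)"
    by (rule M.submoduleI) (auto simp: neg H.I_l_closed)
qed

lemma (in cring) ideal_smult_regular:
  assumes "ideal I R"
  shows "ideal_smult R I (regular_module R) = I"
proof -
  interpret I: ideal I R by fact
  have "I \<subseteq> H" if "{a \<otimes> x | a x. a \<in> I \<and> x \<in> carrier R} \<subseteq> H" for H
  proof
    fix a assume a: "a \<in> I"
    then have "a = a \<otimes> \<one>" by simp
    then have "a \<in> {a \<otimes> x | a x. a \<in> I \<and> x \<in> carrier R}" using a by blast
    then show "a \<in> H" using that by blast
  qed
  moreover have "{a \<otimes> x | a x. a \<in> I \<and> x \<in> carrier R} \<subseteq> I" using I.I_r_closed by blast
  ultimately show ?thesis
    unfolding ideal_smult_def module_span_def submodule_regular_iff using assms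
    by (simp only: regular_module_simps) blast
qed

lemma (in cring) regular_coset_eq_iff:
  assumes "ideal I R" "y \<in> carrier R"
  shows "I +>\<^bsub>regular_module R\<^esub> y = I \<longleftrightarrow> y \<in> I"
proof -
  interpret I: ideal I R by fact
  have c: "I +>\<^bsub>regular_module R\<^esub> y = I +> y" by (simp add: a_r_coset_def')
  show ?thesis unfolding c
    by (metis I.a_rcos_const I.a_rcos_self assms(2))
qed

lemma (in cring) regular_element_quot_regular:
  assumes I: "ideal I R" and a: "a \<in> carrier R"
  shows "regular_element (quot_module (regular_module R) I) a \<longleftrightarrow>
    (\<forall>x\<in>carrier R. a \<otimes> x \<in> I \<longrightarrow> x \<in> I)"
proof -
  interpret I: ideal I R by fact
  let ?c = "\<lambda>x. I +>\<^bsub>regular_module R\<^esub> x"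
  \<comment> \<open>Scalar multiplication on the quotient is a union over all representatives of a
    coset; all of them contribute the same coset.\<close>
  have sm: "(\<Union>x\<in>?c y. ?c (a \<otimes> x)) = I \<longleftrightarrow> a \<otimes> y \<in> I" if y: "y \<in> carrier R" for y
  proof -
    have "?c (a \<otimes> x) = ?c (a \<otimes> y)" if x: "x \<in> ?c y" for x
    proof -
      obtain h where h: "h \<in> I" "x = h \<oplus> y" using x by (auto simp: a_r_coset_def')
      then have x: "a \<otimes> x = a \<otimes> h \<oplus> a \<otimes> y" using a y by (simp add: r_distr)
      have "a \<otimes> h \<in> I" using h a I.I_l_closed by blast
      then have "a \<otimes> x \<in> I +> (a \<otimes> y)" using x by (auto simp: a_r_coset_def')
      then have "I +> (a \<otimes> x) = I +> (a \<otimes> y)"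
        using a_repr_independence[OF _ _ I.a_subgroup, of "a \<otimes> x" "a \<otimes> y"] a y by simp
      then show ?thesis by (simp add: a_r_coset_def')
    qed
    moreover have "y \<in> ?c y" using y by (auto simp: a_r_coset_def' intro!: bexI[of _ \<zero>])
    ultimately have "(\<Union>x\<in>?c y. ?c (a \<otimes> x)) = ?c (a \<otimes> y)" by blast
    then show ?thesis using regular_coset_eq_iff[OF I] a y by simp
  qed
  have "regular_element (quot_module (regular_module R) I) a \<longleftrightarrow>
      (\<forall>y\<in>carrier R. (\<Union>x\<in>?c y. ?c (a \<otimes> x)) = I \<longrightarrow> ?c y = I)"
    by (auto simp: regular_element_def quot_module_def A_RCOSETS_def')
  then show ?thesis using sm regular_coset_eq_iff[OF I] by simp
qed

lemma (in cring) zero_module_quot_regular: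
  assumes I: "ideal I R"
  shows "zero_module (quot_module (regular_module R) I) \<longleftrightarrow> I = carrier R"
proof -
  interpret I: ideal I R by fact
  have "zero_module (quot_module (regular_module R) I) \<longleftrightarrow>
      (\<forall>y\<in>carrier R. I +>\<^bsub>regular_module R\<^esub> y = I)"
    by (auto simp: zero_module_def quot_module_def A_RCOSETS_def')
  then show ?thesis using regular_coset_eq_iff[OF I] I.a_subset by auto
qed

lemma (in cring) regular_sequence_regular_iff:
  assumes xs: "set xs \<subseteq> carrier R"
  shows "regular_sequence R (regular_module R) xs \<longleftrightarrow>
    (\<forall>i<length xs. \<forall>a\<in>carrier R. xs ! i \<otimes> a \<in> Idl (set (take i xs)) \<longrightarrow> a \<in> Idl (set (take i xs))) \<and>
    Idl (set xs) \<noteq> carrier R"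
proof -
  have I: "ideal (Idl (set (take i xs))) R" for i
    using xs set_take_subset[of i xs] by (intro genideal_ideal) blast
  have x: "xs ! i \<in> carrier R" if "i < length xs" for i using xs that by auto
  show ?thesis
    unfolding regular_sequence_def
    using xs x by (simp add: ideal_smult_regular[OF I] ideal_smult_regular[OF genideal_ideal[OF xs]]
        regular_element_quot_regular[OF I] zero_module_quot_regular[OF genideal_ideal[OF xs]])
qed

section \<open>Units and maximal regular sequences in a local ring\<close>

lemma local_ring_max_ideal:
  assumes "local_ring R"
  shows "maximalideal (max_ideal R) R"
  using assms unfolding local_ring_def max_ideal_def by (intro theI'[where P = "\<lambda>I. maximalideal I R"]) simp

text \<open>A nonunit generates a proper ideal, which the chain condition places inside a maximal
  ideal, and the only one is \<open>max_ideal R\<close>.\<close>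

lemma not_in_max_ideal_imp_unit:
  fixes R (structure)
  assumes local: "local_ring R" and noeth: "noetherian_ring R"
    and a: "a \<in> carrier R" "a \<notin> max_ideal R"
  shows "a \<in> Units R"
proof (rule ccontr)
  interpret cring R using local by (simp add: local_ring_def)
  interpret noetherian_ring R by fact
  assume nu: "a \<notin> Units R"
  let ?S = "{I. ideal I R \<and> I \<noteq> carrier R}"
  have "\<one>\<^bsub>R\<^esub> \<notin> PIdl a"
  proof
    assume "\<one>\<^bsub>R\<^esub> \<in> PIdl a"
    then obtain b where "b \<in> carrier R" "b \<otimes> a = \<one>" by (auto simp: cgenideal_def)
    then have "a \<in> Units R" using a(1) m_comm[of a b] by (auto simp: Units_def)
    then show False using nu by simp
  qed
  then have "PIdl a \<noteq> carrier R" by auto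
  then have "PIdl a \<in> ?S" using cgenideal_ideal[OF a(1)] by simp
  then have "\<exists>I\<in>?S. PIdl a \<subseteq> I \<and> (\<forall>K\<in>?S. I \<subseteq> K \<longrightarrow> K = I)"
    by (intro exists_maximal_above) auto
  then obtain I where I: "ideal I R" "I \<noteq> carrier R" "PIdl a \<subseteq> I"
    and max: "\<And>K. ideal K R \<Longrightarrow> K \<noteq> carrier R \<Longrightarrow> I \<subseteq> K \<Longrightarrow> K = I" by auto
  have "maximalideal I R" using I max by (intro maximalidealI) auto
  then have "I = max_ideal R"
    using local local_ring_max_ideal[OF local] unfolding local_ring_def by blast
  then show False using I(3) cgenideal_self[OF a(1)] a(2) by blast
qed

text \<open>A finite depth bounds the lengths of regular sequences in \<open>max_ideal R\<close>, so
  the supremum is an attained maximum, and a sequence attaining it cannot be prolonged.\<close>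

lemma maximal_regular_sequence:
  fixes R (structure)
  assumes local: "local_ring R" and depth: "depth R (regular_module R) = enat t"
  obtains xs where "length xs = t" "set xs \<subseteq> max_ideal R"
    "regular_sequence R (regular_module R) xs"
    "\<And>a. a \<in> max_ideal R \<Longrightarrow> \<not> regular_sequence R (regular_module R) (xs @ [a])"
proof -
  let ?P = "\<lambda>xs. set xs \<subseteq> max_ideal R \<and> regular_sequence R (regular_module R) xs"
  let ?S = "{enat (length xs) | xs. ?P xs}"
  interpret cring R using local by (simp add: local_ring_def)
  interpret m: maximalideal "max_ideal R" R by (rule local_ring_max_ideal[OF local])
  have sup: "Sup ?S = enat t" using depth by (auto simp: depth_def split: if_splits)
  have le: "length xs \<le> t" if "?P xs" for xs
  proof -
    have "enat (length xs) \<le> Sup ?S" by (rule Sup_upper) (use that in blast)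
    then show ?thesis using sup by simp
  qed
  \<comment> \<open>The empty sequence is regular because the zero ideal is proper, so the set of
    lengths is nonempty.\<close>
  have "Idl {} \<subseteq> max_ideal R" by (rule genideal_minimal) (auto simp: m.is_ideal)
  then have "Idl {} \<noteq> carrier R" using m.I_notcarr m.a_subset by blast
  then have "?P []" by (simp add: regular_sequence_regular_iff)
  then have ne: "?S \<noteq> {}" by blast
  have fin: "finite ?S"
    by (rule finite_subset[of _ "enat ` {..t}"]) (use le in auto)
  have "Max ?S \<in> ?S" using Max_in[OF fin ne] .
  moreover have "Sup ?S = Max ?S" unfolding Sup_enat_def using fin ne by (simp only: if_True if_False)
  ultimately obtain xs where xs: "length xs = t" "?P xs" using sup by auto
  have "\<not> regular_sequence R (regular_module R) (xs @ [a])" if "a \<in> max_ideal R" for a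
    using le[of "xs @ [a]"] xs that by auto
  then show ?thesis using that xs by blast
qed

text \<open>The class of \<open>y\<close> is a nonzero socle element of \<open>R/(xs)\<close>. Since
  \<open>xs\<close> cannot be prolonged, each element of \<open>max_ideal R\<close> is a zero
  divisor modulo \<open>Idl (set xs)\<close>, and a single \<open>y\<close> then works for all of
  them.\<close>

lemma depth_socle:
  fixes R (structure)
  assumes local: "local_ring R" and noeth: "noetherian_ring R"
    and depth: "depth R (regular_module R) = enat t"
  obtains xs y where "length xs = t" "set xs \<subseteq> carrier R"
    "regular_sequence R (regular_module R) xs"
    "y \<in> carrier R - genideal R (set xs)"
    "\<And>a. a \<in> max_ideal R \<Longrightarrow> a \<otimes>\<^bsub>R\<^esub> y \<in> genideal R (set xs)"
proof -
  interpret cring R using local by (simp add: local_ring_def)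
  interpret m: maximalideal "max_ideal R" R by (rule local_ring_max_ideal[OF local])
  obtain xs where xs: "length xs = t" "set xs \<subseteq> max_ideal R"
    and reg: "regular_sequence R (regular_module R) xs"
    and max: "\<And>a. a \<in> max_ideal R \<Longrightarrow> \<not> regular_sequence R (regular_module R) (xs @ [a])"
    by (rule maximal_regular_sequence[OF local depth], rule that)
  have xc: "set xs \<subseteq> carrier R" using xs m.a_subset by blast
  have zd: "\<exists>y\<in>carrier R - Idl (set xs). a \<otimes> y \<in> Idl (set xs)" if a: "a \<in> max_ideal R" for a
  proof (rule ccontr)
    assume n: "\<not> ?thesis"
    have xa: "set (xs @ [a]) \<subseteq> carrier R" using xc a m.a_subset by auto
    have "Idl (set (xs @ [a])) \<subseteq> max_ideal R"
      using xs a by (intro genideal_minimal) (auto simp: m.is_ideal)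
    then have "Idl (set (xs @ [a])) \<noteq> carrier R" using m.I_notcarr m.a_subset by blast
    moreover have "(xs @ [a]) ! i \<otimes> b \<in> Idl (set (take i (xs @ [a]))) \<longrightarrow>
        b \<in> Idl (set (take i (xs @ [a])))" if "i < length (xs @ [a])" "b \<in> carrier R" for i b
    proof (cases "i < length xs")
      case True
      then show ?thesis
        using reg that unfolding regular_sequence_regular_iff[OF xc] by (auto simp: nth_append)
    next
      case False
      \<comment> \<open>At the last index the condition says that \<open>a\<close> is a
        nonzerodivisor modulo \<open>Idl (set xs)\<close>, which is the assumption
        \<open>n\<close>.\<close>
      then have "i = length xs" using that by simp
      then show ?thesis using n that by auto
    qed
    ultimately have "regular_sequence R (regular_module R) (xs @ [a])"
      unfolding regular_sequence_regular_iff[OF xa] by blast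
    then show False using max[OF a] by simp
  qed
  have "\<exists>y\<in>carrier R - Idl (set xs). \<forall>a\<in>max_ideal R. a \<otimes> y \<in> Idl (set xs)"
    by (rule zero_divisor_ideal_annihilated[OF noeth genideal_ideal[OF xc] m.is_ideal zd])
  then show ?thesis using that[OF xs(1) xc reg] by blast
qed

section \<open>Cochains modulo a regular sequence\<close>

text \<open>The coset of the cocycle \<open>f\<close> is the zero coset, which is the set of
  coboundaries itself; and \<open>f\<close> lies in its own coset because the zero cochain is a
  coboundary.\<close>

lemma Ext_zero_imp_coboundary:
  assumes M: "module R M" and N: "module R N" and Ext: "zero_module (Ext R (Suc i) M N)"
    and f: "f \<in> mod_hom R (res_term R M (Suc i)) N"
    and cocycle: "\<And>v. v \<in> carrier (res_term R M (Suc (Suc i))) \<Longrightarrow> f (res_diff R M (Suc i) v) = \<zero>\<^bsub>N\<^esub>"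
  shows "\<exists>g\<in>mod_hom R (res_term R M i) N. \<forall>v\<in>carrier (res_term R M (Suc i)). f v = g (res_diff R M i v)"
proof -
  interpret N: module R N by fact
  let ?F = "res_term R M" and ?d = "res_diff R M"
  let ?Z = "cocycles R ?F ?d N (Suc i)" and ?B = "coboundaries R ?F ?d N (Suc i)"
  let ?H = "(Hom_module R (?F (Suc i)) N)\<lparr>carrier := ?Z\<rparr>"
  note d = mod_homD(1)[OF free_resolution(3)[OF M]]
  have fZ: "f \<in> ?Z"
    using f cocycle by (auto simp: cocycles_def a_kernel_eq Hom_module_def Hom_diff_def)
  have "(\<lambda>x\<in>carrier (?F i). \<zero>\<^bsub>N\<^esub>) \<in> mod_hom R (?F i) N"
  proof -
    interpret F: module R "?F i" unfolding res_term_def by (rule module_free_module) (rule N.R.is_cring)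
    show ?thesis by (rule mod_homI) auto
  qed
  then have zB: "(\<lambda>x\<in>carrier (?F (Suc i)). \<zero>\<^bsub>N\<^esub>) \<in> ?B"
    unfolding coboundaries.simps
    by (intro image_eqI[where x = "\<lambda>x\<in>carrier (?F i). \<zero>\<^bsub>N\<^esub>"])
      (auto simp: Hom_diff_def Hom_module_def d)
  have "?B +>\<^bsub>?H\<^esub> f \<in> carrier (Ext R (Suc i) M N)"
    using fZ unfolding Ext_def Hom_cohomology_def quot_module_def
    by (auto simp: A_RCOSETS_def')
  then have B: "?B +>\<^bsub>?H\<^esub> f = ?B"
    using Ext unfolding zero_module_def unfolding Ext_def Hom_cohomology_def quot_module_def by simp
  have "f = (\<lambda>x\<in>carrier (?F (Suc i)). \<zero>\<^bsub>N\<^esub>) \<oplus>\<^bsub>?H\<^esub> f"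
    using mod_homD(1,2)[OF f]
    by (auto simp: Hom_module_def fun_eq_iff restrict_def extensional_def)
  then have "f \<in> ?B +>\<^bsub>?H\<^esub> f" using zB unfolding a_r_coset_def' by blast
  then have "f \<in> ?B" using B by simp
  then show ?thesis by (auto simp: Hom_module_def Hom_diff_def)
qed

text \<open>Each entry is a nonzerodivisor modulo its predecessors, and \<open>Idl (set xs)\<close>
  may be the whole ring.\<close>

locale weakly_regular_sequence = cring R for R (structure) +
  fixes xs :: "'a list"
  assumes xs_closed: "set xs \<subseteq> carrier R"
    and xs_regular: "\<lbrakk>j < length xs; a \<in> carrier R; xs ! j \<otimes> a \<in> Idl (set (take j xs))\<rbrakk>
      \<Longrightarrow> a \<in> Idl (set (take j xs))"
begin

definition I :: "nat \<Rightarrow> 'a set" where "I j = Idl (set (take j xs))"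

lemma ideal_I: "ideal (I j) R"
  unfolding I_def using xs_closed set_take_subset[of j xs] by (intro genideal_ideal) blast

lemma I_0: "I 0 = {\<zero>}"
proof -
  have "Idl {} \<subseteq> {\<zero>}" by (rule genideal_minimal[OF zeroideal]) simp
  then show ?thesis
    using additive_subgroup.zero_closed[OF ideal.axioms(1)[OF ideal_I[of 0]]] by (auto simp: I_def)
qed

section \<open>Congruences between \<open>I j\<close> and \<open>I (Suc j)\<close>, which adds the
  generator \<open>xs ! j\<close>\<close>

context
  fixes j assumes j: "j < length xs"
begin

lemma xs_nth_closed: "xs ! j \<in> carrier R"
  using j xs_closed by auto

lemma I_regular: "\<lbrakk>a \<in> carrier R; xs ! j \<otimes> a \<in> I j\<rbrakk> \<Longrightarrow> a \<in> I j"
  unfolding I_def using j by (rule xs_regular)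

lemma set_take_Suc: "set (take (Suc j) xs) = insert (xs ! j) (set (take j xs))"
  using j by (simp add: take_Suc_conv_app_nth)

lemma set_take_closed: "set (take k xs) \<subseteq> carrier R"
  using xs_closed set_take_subset[of k xs] by blast

lemma I_mono: "I j \<subseteq> I (Suc j)"
  unfolding I_def by (rule subset_Idl_subset[OF set_take_closed]) (auto simp: set_take_Suc)

lemma nth_in_I: "xs ! j \<in> I (Suc j)"
  unfolding I_def using genideal_self[OF set_take_closed, of "Suc j"] set_take_Suc by blast

lemma I_SucD: "a \<in> I (Suc j) \<Longrightarrow> \<exists>c\<in>carrier R. a \<ominus> xs ! j \<otimes> c \<in> I j"
  unfolding I_def set_take_Suc by (rule genideal_insertD[OF set_take_closed xs_nth_closed])

lemma I_SucI:
  assumes "a \<in> carrier R" "c \<in> carrier R" "a \<ominus> xs ! j \<otimes> c \<in> I j"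
  shows "a \<in> I (Suc j)"
proof -
  interpret S: ideal "I (Suc j)" R by (rule ideal_I)
  have "a \<ominus> xs ! j \<otimes> c \<in> I (Suc j)" using assms I_mono by blast
  moreover have "xs ! j \<otimes> c \<in> I (Suc j)" using nth_in_I assms S.I_r_closed by blast
  ultimately have "(a \<ominus> xs ! j \<otimes> c) \<oplus> xs ! j \<otimes> c \<in> I (Suc j)" by simp
  moreover have "(a \<ominus> xs ! j \<otimes> c) \<oplus> xs ! j \<otimes> c = a" using assms xs_nth_closed by algebra
  ultimately show ?thesis by simp
qed

text \<open>It allows a quotient \<open>b\<close> of \<open>a\<close> by \<open>xs ! j\<close> to be
  exchanged for a better representative, such as a cocycle.\<close>

lemma I_mult_cong:
  assumes "a \<in> carrier R" "b \<in> carrier R" "c \<in> carrier R"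
    and "a \<ominus> xs ! j \<otimes> b \<in> I j" "b \<ominus> c \<in> I j"
  shows "a \<ominus> xs ! j \<otimes> c \<in> I j"
proof -
  interpret J: ideal "I j" R by (rule ideal_I)
  have "(a \<ominus> xs ! j \<otimes> b) \<oplus> xs ! j \<otimes> (b \<ominus> c) \<in> I j"
    using assms xs_nth_closed J.I_l_closed by simp
  moreover have "(a \<ominus> xs ! j \<otimes> b) \<oplus> xs ! j \<otimes> (b \<ominus> c) = a \<ominus> xs ! j \<otimes> c"
    using assms(1-3) xs_nth_closed by algebra
  ultimately show ?thesis by simp
qed

text \<open>The form in which regularity is used: the zero on the left arises from composing two
  consecutive maps of the resolution.\<close>

lemma I_regular_neg:
  assumes "b \<in> carrier R" "\<zero> \<ominus> xs ! j \<otimes> b \<in> I j"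
  shows "b \<in> I j"
proof -
  interpret J: ideal "I j" R by (rule ideal_I)
  have "\<ominus> (\<zero> \<ominus> xs ! j \<otimes> b) \<in> I j" using assms by simp
  moreover have "\<ominus> (\<zero> \<ominus> xs ! j \<otimes> b) = xs ! j \<otimes> b" using assms(1) xs_nth_closed by algebra
  ultimately show ?thesis using I_regular assms(1) by simp
qed

end

text \<open>The long exact sequences of \<open>0 \<rightarrow> R/I j \<rightarrow> R/I j \<rightarrow> R/I (Suc j) \<rightarrow> 0\<close> in terms of
  cochains: since the resolution is free, cochains with values in \<open>R/I j\<close> are represented by
  cochains with values in \<open>R\<close>, so that no quotient module is needed.\<close>

lemma cocycle_mod_I_lift:
  assumes M: "module R M"
    and Ext: "\<And>i. 1 \<le> i \<Longrightarrow> i \<le> n \<Longrightarrow> zero_module (Ext R i M (regular_module R))"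
    and "i + j \<le> n" "j \<le> length xs"
    and "f \<in> mod_hom R (res_term R M i) (regular_module R)"
    and "\<And>v. v \<in> carrier (res_term R M (Suc i)) \<Longrightarrow> f (res_diff R M i v) \<in> I j"
  shows "\<exists>u\<in>mod_hom R (res_term R M i) (regular_module R).
    (\<forall>v\<in>carrier (res_term R M (Suc i)). u (res_diff R M i v) = \<zero>) \<and>
    (\<forall>v\<in>carrier (res_term R M i). f v \<ominus> u v \<in> I j)"
  using assms(3-6)
proof (induction j arbitrary: i f)
  case 0
  then show ?case
    using mod_homD(1)[OF 0(3)] by (intro bexI[of _ f]) (auto simp: I_0 minus_eq r_neg)
next
  case (Suc j)
  let ?F = "res_term R M" and ?d = "res_diff R M" and ?x = "xs ! j" and ?R = "regular_module R"
  have j: "j < length xs" using Suc.prems by simp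
  note x = xs_nth_closed[OF j]
  have F: "module R (?F k)" for k unfolding res_term_def by (rule module_free_module[OF is_cring])
  note R = module_regular_module
  note d = free_resolution(3)[OF M]
  note dc = mod_homD(1)[OF d]
  have dd: "?d i (?d (Suc i) w) = \<zero>\<^bsub>?F i\<^esub>" if "w \<in> carrier (?F (Suc (Suc i)))" for w
    using free_resolution(5)[OF M, of i] that by (auto simp: a_kernel_eq)
  note f = mod_homD(1)[OF Suc.prems(3), simplified]
  let ?f = "\<lambda>v\<in>carrier (?F (Suc i)). f (?d i v)"
  have f': "?f \<in> mod_hom R (?F (Suc i)) ?R" by (rule mod_hom_compose[OF F d Suc.prems(3)])
  \<comment> \<open>Division of the coboundary of \<open>f\<close> by \<open>?x\<close> modulo
    \<open>I j\<close>: this is the connecting homomorphism, with \<open>h\<close> representing the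
    image of \<open>f\<close> in degree \<open>Suc i\<close>.\<close>
  have "\<exists>h\<in>mod_hom R (?F (Suc i)) ?R. \<forall>v\<in>carrier (?F (Suc i)). ?f v \<ominus> ?x \<otimes> h v \<in> I j"
    unfolding res_term_def
    by (rule hom_free_module_split[OF f'[unfolded res_term_def] ideal_I x])
      (use Suc.prems(4) I_SucD[OF j] in \<open>simp add: res_term_def\<close>)
  then obtain h where h: "h \<in> mod_hom R (?F (Suc i)) ?R"
    and fh: "\<And>v. v \<in> carrier (?F (Suc i)) \<Longrightarrow> f (?d i v) \<ominus> ?x \<otimes> h v \<in> I j" by auto
  note hc = mod_homD(1)[OF h, simplified]
  have hI: "h (?d (Suc i) w) \<in> I j" if w: "w \<in> carrier (?F (Suc (Suc i)))" for w
  proof (rule I_regular_neg[OF j hc[OF dc[OF w]]])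
    show "\<zero> \<ominus> ?x \<otimes> h (?d (Suc i) w) \<in> I j"
      using fh[OF dc[OF w]] by (simp only: dd[OF w] mod_hom_zero[OF F R Suc.prems(3)] regular_module_simps)
  qed
  \<comment> \<open>First use of the induction hypothesis: one degree higher, one ideal lower, so
    the bound on \<open>i + j\<close> is kept. It replaces \<open>h\<close> by an exact cocycle
    \<open>u'\<close>.\<close>
  obtain u' where u': "u' \<in> mod_hom R (?F (Suc i)) ?R"
    and u'0: "\<And>w. w \<in> carrier (?F (Suc (Suc i))) \<Longrightarrow> u' (?d (Suc i) w) = \<zero>"
    and hu': "\<And>v. v \<in> carrier (?F (Suc i)) \<Longrightarrow> h v \<ominus> u' v \<in> I j"
    using Suc.IH[OF _ _ h hI] Suc.prems(1,2) by auto
  note u'c = mod_homD(1)[OF u', simplified]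
  \<comment> \<open>The vanishing of \<open>Ext\<close> in degree \<open>Suc i \<le> n\<close> makes
    \<open>u'\<close> a coboundary.\<close>
  obtain g where g: "g \<in> mod_hom R (?F i) ?R"
    and u'g: "\<And>v. v \<in> carrier (?F (Suc i)) \<Longrightarrow> u' v = g (?d i v)"
    using Ext_zero_imp_coboundary[OF M R Ext u'] u'0 Suc.prems(1) by auto
  note gc = mod_homD(1)[OF g, simplified]
  \<comment> \<open>Modulo \<open>I j\<close> the coboundary of \<open>f - x g\<close> is
    \<open>x (h - u')\<close>, hence zero. The induction hypothesis in degree \<open>i\<close> then
    gives \<open>u\<close>, and \<open>f\<close> is congruent to \<open>u + x g\<close>.\<close>
  let ?k = "\<lambda>v\<in>carrier (?F i). f v \<ominus> ?x \<otimes> g v"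
  have k: "?k \<in> mod_hom R (?F i) ?R" by (rule mod_hom_diff_smult[OF F Suc.prems(3) g x])
  have kI: "?k (?d i v) \<in> I j" if v: "v \<in> carrier (?F (Suc i))" for v
    using I_mult_cong[OF j f[OF dc[OF v]] hc[OF v] u'c[OF v] fh[OF v] hu'[OF v]] u'g[OF v] dc[OF v]
    by simp
  obtain u where u: "u \<in> mod_hom R (?F i) ?R"
    and u0: "\<And>w. w \<in> carrier (?F (Suc i)) \<Longrightarrow> u (?d i w) = \<zero>"
    and ku: "\<And>v. v \<in> carrier (?F i) \<Longrightarrow> ?k v \<ominus> u v \<in> I j"
    using Suc.IH[OF _ _ k kI] Suc.prems(1,2) by auto
  note uc = mod_homD(1)[OF u, simplified]
  have "f v \<ominus> u v \<in> I (Suc j)" if v: "v \<in> carrier (?F i)" for v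
  proof (rule I_SucI[OF j _ gc[OF v]])
    have "f v \<ominus> u v \<ominus> ?x \<otimes> g v = f v \<ominus> ?x \<otimes> g v \<ominus> u v"
      using f[OF v] uc[OF v] gc[OF v] x by algebra
    then show "f v \<ominus> u v \<ominus> ?x \<otimes> g v \<in> I j" using ku[OF v] v by simp
  qed (use f[OF v] uc[OF v] in simp)
  then show ?case using u u0 by blast
qed

text \<open>Such an \<open>f\<close> lies in \<open>I j\<close> times the dual of \<open>M\<close>:
  inductively \<open>f = k + x g\<close>, where \<open>k\<close> has values in the previous ideal
  and \<open>g\<close> is a functional on \<open>M\<close>. Then
  \<open>\<phi> f = \<phi> k + x \<phi> g\<close>.\<close>

lemma dual_functional_mod_I:
  assumes M: "module R M"
    and Ext: "\<And>i. 1 \<le> i \<Longrightarrow> i \<le> n \<Longrightarrow> zero_module (Ext R i M (regular_module R))"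
    and \<phi>: "\<phi> \<in> mod_hom R (dual_module R M) (regular_module R)"
    and "j \<le> Suc n" "j \<le> length xs"
    and "f \<in> mod_hom R M (regular_module R)" "\<And>m. m \<in> carrier M \<Longrightarrow> f m \<in> I j"
  shows "\<phi> f \<in> I j"
  using assms(4-7)
proof (induction j arbitrary: f)
  case 0
  let ?D = "dual_module R M"
  have fD: "f \<in> carrier ?D" using 0 by (simp add: dual_module_def Hom_module_def)
  \<comment> \<open>As \<open>I 0\<close> is zero, so is \<open>f\<close>; the form
    \<open>0 f\<close> lets linearity of \<open>\<phi>\<close> finish.\<close>
  have "f = \<zero> \<odot>\<^bsub>?D\<^esub> f"
    using 0(4) mod_homD(2)[OF 0(3)]
    by (auto simp: dual_module_def Hom_module_def I_0 fun_eq_iff extensional_def)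
  then have "\<phi> f = \<zero> \<otimes> \<phi> f" using mod_homD(4)[OF \<phi> zero_closed fD] by simp
  then show ?case using mod_homD(1)[OF \<phi> fD] by (simp add: I_0)
next
  case (Suc j)
  let ?F = "res_term R M" and ?d = "res_diff R M" and ?x = "xs ! j" and ?R = "regular_module R"
  let ?D = "dual_module R M"
  have j: "j < length xs" using Suc.prems by simp
  note x = xs_nth_closed[OF j]
  have F: "module R (?F k)" for k unfolding res_term_def by (rule module_free_module[OF is_cring])
  note R = module_regular_module
  note d = free_resolution(3)[OF M] and p = free_resolution(1)[OF M]
  note dc = mod_homD(1)[OF d] and pc = mod_homD(1)[OF p]
  have pd: "res_aug R M (?d 0 w) = \<zero>\<^bsub>M\<^esub>" if "w \<in> carrier (?F (Suc 0))" for w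
    using free_resolution(4)[OF M] that by (auto simp: a_kernel_eq)
  note f = mod_homD(1)[OF Suc.prems(3), simplified]
  let ?f = "\<lambda>v\<in>carrier (?F 0). f (res_aug R M v)"
  have f': "?f \<in> mod_hom R (?F 0) ?R" by (rule mod_hom_compose[OF F p Suc.prems(3)])
  have "\<exists>h\<in>mod_hom R (?F 0) ?R. \<forall>v\<in>carrier (?F 0). ?f v \<ominus> ?x \<otimes> h v \<in> I j"
    unfolding res_term_def
    by (rule hom_free_module_split[OF f'[unfolded res_term_def] ideal_I x])
      (use Suc.prems(4) I_SucD[OF j] pc in \<open>simp add: res_term_def\<close>)
  then obtain h where h: "h \<in> mod_hom R (?F 0) ?R"
    and fh: "\<And>v. v \<in> carrier (?F 0) \<Longrightarrow> f (res_aug R M v) \<ominus> ?x \<otimes> h v \<in> I j" by auto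
  note hc = mod_homD(1)[OF h, simplified]
  have hI: "h (?d 0 w) \<in> I j" if w: "w \<in> carrier (?F (Suc 0))" for w
  proof (rule I_regular_neg[OF j hc[OF dc[OF w]]])
    show "\<zero> \<ominus> ?x \<otimes> h (?d 0 w) \<in> I j"
      using fh[OF dc[OF w]] by (simp only: pd[OF w] mod_hom_zero[OF M R Suc.prems(3)] regular_module_simps)
  qed
  \<comment> \<open>The quotient of \<open>f\<close> by \<open>?x\<close> is a map from
    \<open>M\<close> to \<open>R/I j\<close>, represented by \<open>h\<close>; lifting it to
    \<open>R\<close> is a question about cocycles of degree 0, and \<open>Suc j \<le> Suc n\<close>
    gives the bound \<open>0 + j \<le> n\<close>.\<close>
  have "\<exists>u\<in>mod_hom R (?F 0) ?R. (\<forall>v\<in>carrier (?F (Suc 0)). u (?d 0 v) = \<zero>) \<and>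
      (\<forall>v\<in>carrier (?F 0). h v \<ominus> u v \<in> I j)"
    using Suc.prems(1,2) by (intro cocycle_mod_I_lift[OF M Ext _ _ h hI]) auto
  then obtain u where u: "u \<in> mod_hom R (?F 0) ?R"
    and u0: "\<And>w. w \<in> carrier (?F (Suc 0)) \<Longrightarrow> u (?d 0 w) = \<zero>"
    and hu: "\<And>v. v \<in> carrier (?F 0) \<Longrightarrow> h v \<ominus> u v \<in> I j" by auto
  note uc = mod_homD(1)[OF u, simplified]
  \<comment> \<open>By exactness at \<open>res_term R M 0\<close>, the cocycle \<open>u\<close>
    kills the kernel of the augmentation and so descends to \<open>g\<close> on
    \<open>M\<close>.\<close>
  have "u v = \<zero>" if "v \<in> carrier (?F 0)" "res_aug R M v = \<zero>\<^bsub>M\<^esub>" for v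
  proof -
    have "v \<in> ?d 0 ` carrier (?F 1)"
      unfolding free_resolution(4)[OF M] using that by (simp add: a_kernel_eq)
    then show ?thesis using u0 by auto
  qed
  then obtain g where g: "g \<in> mod_hom R M ?R"
    and gu: "\<And>v. v \<in> carrier (?F 0) \<Longrightarrow> g (res_aug R M v) = u v"
    using mod_hom_factor_surj[OF F M R p free_resolution(2)[OF M] u] by auto
  note gc = mod_homD(1)[OF g, simplified]
  let ?k = "\<lambda>m\<in>carrier M. f m \<ominus> ?x \<otimes> g m"
  have k: "?k \<in> mod_hom R M ?R" by (rule mod_hom_diff_smult[OF M Suc.prems(3) g x])
  have "?k m \<in> I j" if m: "m \<in> carrier M" for m
  proof -
    have "m \<in> res_aug R M ` carrier (?F 0)" using free_resolution(2)[OF M] m by simp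
    then obtain v where v: "v \<in> carrier (?F 0)" "m = res_aug R M v" by auto
    show ?thesis
      using I_mult_cong[OF j f[OF pc[OF v(1)]] hc[OF v(1)] uc[OF v(1)] fh[OF v(1)] hu[OF v(1)]]
        gu[OF v(1)] m v(2) by simp
  qed
  then have \<phi>k: "\<phi> ?k \<in> I j" using Suc.prems(1,2) by (intro Suc.IH[OF _ _ k]) auto
  have D: "f \<in> carrier ?D" "g \<in> carrier ?D" "?k \<in> carrier ?D"
    using Suc.prems(3) g k by (simp_all add: dual_module_def Hom_module_def)
  have xg: "?x \<odot>\<^bsub>?D\<^esub> g \<in> carrier ?D"
    by (rule module.smult_closed[OF module_dual_module[OF M] x D(2)])
  have "(f m \<ominus> ?x \<otimes> g m) \<oplus> ?x \<otimes> g m = f m" if "m \<in> carrier M" for m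
    using f[OF that] gc[OF that] x by algebra
  then have "f = ?k \<oplus>\<^bsub>?D\<^esub> (?x \<odot>\<^bsub>?D\<^esub> g)"
    using mod_homD(2)[OF Suc.prems(3)]
    by (auto simp: dual_module_def Hom_module_def fun_eq_iff extensional_def)
  then have "\<phi> f = \<phi> ?k \<oplus> ?x \<otimes> \<phi> g"
    using mod_homD(3)[OF \<phi> D(3) xg] mod_homD(4)[OF \<phi> x D(2)] by simp
  moreover have "a \<oplus> b \<ominus> b = a" if "a \<in> carrier R" "b \<in> carrier R" for a b
    using that by algebra
  then have "\<phi> ?k \<oplus> ?x \<otimes> \<phi> g \<ominus> ?x \<otimes> \<phi> g = \<phi> ?k"
    using mod_homD(1)[OF \<phi> D(2)] mod_homD(1)[OF \<phi> D(3)] x by simp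
  ultimately show ?case
    using \<phi>k mod_homD(1)[OF \<phi> D(1)] mod_homD(1)[OF \<phi> D(2)] by (intro I_SucI[OF j, where c = "\<phi> g"]) auto
qed

end

section \<open>Descending a free summand from the dual\<close>

theorem lemma5p14:
  fixes R :: "('a, 'r) ring_scheme"
    and M :: "('a, 'm, 's) module_scheme"
    and t :: nat
  assumes "local_ring R"
    and "noetherian_ring R"
    and "depth R (regular_module R) = enat t"
    and "module R M"
    and "finitely_generated R M"
    and "enat (t - 1) \<le> depth R M"
    and "\<forall>i. 1 \<le> i \<and> i \<le> t - 1 \<longrightarrow> zero_module (Ext R i M (regular_module R))"
    and "direct_summand R (regular_module R) (dual_module R M)"
  shows "direct_summand R (regular_module R) M"
proof -
  interpret cring R using assms(1) by (simp add: local_ring_def)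
  let ?D = "dual_module R M"
  interpret D: module R ?D by (rule module_dual_module[OF assms(4)])
  obtain \<phi> f where \<phi>: "\<phi> \<in> mod_hom R ?D (regular_module R)"
    and f: "f \<in> carrier ?D" "\<phi> f = \<one>\<^bsub>R\<^esub>"
    using direct_summand_regular_imp_functional[OF D.module_axioms assms(8)] by blast
  have hom: "carrier ?D = mod_hom R M (regular_module R)" by (simp add: dual_module_def Hom_module_def)
  obtain xs y where xs: "length xs = t" "set xs \<subseteq> carrier R"
    and reg: "regular_sequence R (regular_module R) xs"
    and y: "y \<in> carrier R - Idl\<^bsub>R\<^esub> (set xs)"
    and my: "\<And>a. a \<in> max_ideal R \<Longrightarrow> a \<otimes>\<^bsub>R\<^esub> y \<in> Idl\<^bsub>R\<^esub> (set xs)"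
    by (rule depth_socle[OF assms(1-3)], rule that)
  interpret W: weakly_regular_sequence R xs
    by unfold_locales (use reg xs in \<open>auto simp: regular_sequence_regular_iff\<close>)
  have "\<exists>z\<in>carrier M. f z \<notin> max_ideal R"
  proof (rule ccontr)
    assume n: "\<not> ?thesis"
    let ?g = "y \<odot>\<^bsub>?D\<^esub> f"
    have It: "W.I t = Idl\<^bsub>R\<^esub> (set xs)" using xs(1) by (simp add: W.I_def)
    have g: "?g \<in> carrier ?D" using y f(1) by simp
    have "?g m \<in> W.I t" if m: "m \<in> carrier M" for m
    proof -
      have "?g m = f m \<otimes>\<^bsub>R\<^esub> y"
        using m y mod_homD(1)[OF f(1)[unfolded hom] m]
        by (simp add: dual_module_def Hom_module_def m_comm)
      then show ?thesis using my n m It by simp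
    qed
    \<comment> \<open>The bound \<open>t \<le> Suc (t - 1)\<close> also holds for
      \<open>t = 0\<close>, where the subtraction is truncated.\<close>
    then have "\<phi> ?g \<in> W.I t"
      using assms(7) xs(1) g unfolding hom
      by (intro W.dual_functional_mod_I[OF assms(4) _ \<phi>, where n = "t - 1"]) auto
    moreover have "\<phi> ?g = y" using mod_homD(4)[OF \<phi> _ f(1)] y f(2) by simp
    ultimately show False using y It by simp
  qed
  then obtain z where z: "z \<in> carrier M" "f z \<notin> max_ideal R" by blast
  interpret M: module R M by fact
  have fz: "f z \<in> carrier R" using mod_homD(1)[OF f(1)[unfolded hom] z(1)] by simp
  then have u: "f z \<in> Units R" using not_in_max_ideal_imp_unit[OF assms(1,2)] z by blast
  show ?thesis
  \<comment> \<open>Since \<open>f z\<close> is a unit, \<open>z\<close> can be rescaled so that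
    \<open>f\<close> takes the value one on it.\<close>
  proof (rule functional_imp_direct_summand_regular[OF assms(4) f(1)[unfolded hom]])
    show "inv\<^bsub>R\<^esub> (f z) \<odot>\<^bsub>M\<^esub> z \<in> carrier M" using u z by simp
    show "f (inv\<^bsub>R\<^esub> (f z) \<odot>\<^bsub>M\<^esub> z) = \<one>\<^bsub>R\<^esub>"
      using mod_homD(4)[OF f(1)[unfolded hom] Units_inv_closed[OF u] z(1)] u by simp
  qed
qed

end
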